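(* Let $\Lambda,\delta>0$, $T=L(\Lambda+1)\delta$ with $L\in\mathbb N$, and $0<s<1$. The minimizers of $\mathcal F^T_s$ in $\mathscr A^{T,\Lambda,\delta}$ are exactly the functions $\bar u(\cdot-x_0)+y_0$ with $x_0,y_0\in\mathbb R$.
   Context: The admissible class $\mathscr A^{T,\Lambda,\delta}$ is the set of continuous, $T$-periodic, piecewise affine functions $u:\mathbb R\to\mathbb R$ with $u'\in\{1,-\Lambda\}$ a.e., such that $(u')^{-1}(\{-\Lambda\})=\bigcup_{k\in\mathbb N}I^k$ for some intervals $I^k$ with $|I^k|=\delta$ for all $k$ and $\#(I^i\cap I^j)\le1$ for all $i\ne j$. For $0<s<1$, $$\mathcal F^T_s(u):=\frac1{2T}\int_0^T dx\int_{\mathbb R}\frac{|u(x)-u(y)|^2}{|x-y|^{1+2s}}\,dy.$$ $\bar u$ is the $(\Lambda+1)\delta$-periodic function defined on $(-\delta,\Lambda\delta]$ by $\bar u(x)=-\Lambda x$ for $-\delta<x<0$ and $\bar u(x)=x$ for $0\le x\le\Lambda\delta$ (it belongs to $\mathscr A^{T,\Lambda,\delta}$). *)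

theory Defs
  imports "HOL-Analysis.Analysis"
begin

definition piecewise_affine :: "(real \<Rightarrow> real) \<Rightarrow> bool" where
  "piecewise_affine u \<longleftrightarrow>
     (\<exists>S. (\<forall>a b. finite (S \<inter> {a..b})) \<and>
          (\<forall>x y. x < y \<and> {x<..<y} \<inter> S = {} \<longrightarrow>
                 (\<exists>m c. \<forall>t\<in>{x..y}. u t = m * t + c)))"

text \<open>The admissible class A^{T,Lambda,delta}.  The derivative u' is only defined a.e.,
  so the identity (u')^{-1}({-Lambda}) = U_k I^k is understood up to Lebesgue-null sets.\<close>
definition admissible :: "real \<Rightarrow> real \<Rightarrow> real \<Rightarrow> (real \<Rightarrow> real) set" where
  "admissible T \<Lambda> \<delta> = {u.
     continuous_on UNIV u \<and>
     (\<forall>x. u (x + T) = u x) \<and>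
     piecewise_affine u \<and>
     (AE x in lborel. (u has_real_derivative 1) (at x) \<or> (u has_real_derivative (- \<Lambda>)) (at x)) \<and>
     (\<exists>I :: nat \<Rightarrow> real set.
        (\<forall>k. is_interval (I k) \<and> emeasure lborel (I k) = ennreal \<delta>) \<and>
        (\<forall>i j. i \<noteq> j \<longrightarrow> finite (I i \<inter> I j) \<and> card (I i \<inter> I j) \<le> 1) \<and>
        (AE x in lborel. ((u has_real_derivative (- \<Lambda>)) (at x) \<longleftrightarrow> x \<in> (\<Union>k. I k))))}"

definition F_s :: "real \<Rightarrow> real \<Rightarrow> (real \<Rightarrow> real) \<Rightarrow> ennreal" where
  "F_s T s u = ennreal (1 / (2 * T)) *
     (\<integral>\<^sup>+ x \<in> {0..T}. (\<integral>\<^sup>+ y. ennreal (\<bar>u x - u y\<bar>\<^sup>2 / \<bar>x - y\<bar> powr (1 + 2 * s)) \<partial>lborel) \<partial>lborel)"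

text \<open>ubar: (Lambda+1)delta-periodic, equal to -Lambda x on (-delta,0) and x on [0,Lambda delta].
  r is the representative of x modulo (Lambda+1)delta in (-delta, Lambda delta].\<close>
definition ubar :: "real \<Rightarrow> real \<Rightarrow> real \<Rightarrow> real" where
  "ubar \<Lambda> \<delta> x =
     (let P = (\<Lambda> + 1) * \<delta>;
          r = x - P * of_int \<lceil>(x - \<Lambda> * \<delta>) / P\<rceil>
      in if r < 0 then - \<Lambda> * r else r)"

end

theory Submission
  imports Defs "HOL-Library.Periodic_Fun"
begin

text \<open>An admissible function drops with slope \<open>-\<Lambda>\<close> on intervals \<open>[a k, a k + \<delta>)\<close>, \<open>k \<in> \<int>\<close>, with
  \<open>a (k + 1) \<ge> a k + \<delta>\<close> and \<open>a (k + L) = a k + T\<close>. Substituting \<open>y = x + h\<close>, the energy is an integral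
  over \<open>h\<close>, with positive weight, of \<open>D h = \<integral>\<^sub>0\<^sup>T (u (x + h) - u x)^2 dx\<close>, so it suffices to compare \<open>D h\<close> for
  each fixed \<open>h > 0\<close>. As \<open>u (x + h) - u x = h - (1 + \<Lambda>) |A \<inter> [x, x + h]|\<close> for the union \<open>A\<close> of the drops,
  \<open>D h\<close> is, up to constants, the integral of \<open>|A \<inter> [x, x + h]|^2\<close>, which unfolds to
  \<open>\<Sum>m \<in> \<int>. \<integral>\<integral> \<Sum>i < L. max 0 (h - |a (i + m) - a i + w - v|)\<close> with \<open>v, w\<close> ranging over \<open>[0, \<delta>)\<close>. For
  fixed \<open>m \<noteq> 0\<close> the separation of the drops makes the sign of \<open>a (i + m) - a i + w - v\<close> constant, and the
  gaps \<open>a (i + m) - a i\<close> sum to \<open>m T\<close>; hence Jensen's inequality for the positive part shows that equal gaps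
  minimize each inner sum. If the gaps for \<open>m = 1\<close> are not all equal, the inequality is strict for an open
  set of \<open>h\<close>.\<close>

section \<open>Lebesgue integrals over one period\<close>

lemma nn_integral_translate:
  fixes f :: "real \<Rightarrow> ennreal"
  assumes [measurable]: "f \<in> borel_measurable borel"
  shows "(\<integral>\<^sup>+x. f (x + c) \<partial>lborel) = (\<integral>\<^sup>+x. f x \<partial>lborel)"
  using nn_integral_real_affine[of f 1 c] by (simp add: add.commute)

lemma nn_integral_translate_Ico:
  fixes f :: "real \<Rightarrow> ennreal"
  assumes [measurable]: "f \<in> borel_measurable borel"
  shows "(\<integral>\<^sup>+x\<in>{a..<b}. f (x + c) \<partial>lborel) = (\<integral>\<^sup>+x\<in>{a + c..<b + c}. f x \<partial>lborel)"
proof -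
  have "(\<integral>\<^sup>+x\<in>{a + c..<b + c}. f x \<partial>lborel) = (\<integral>\<^sup>+x. f (x + c) * indicator {a + c..<b + c} (x + c) \<partial>lborel)"
    by (rule nn_integral_translate[symmetric]) measurable
  also have "\<dots> = (\<integral>\<^sup>+x\<in>{a..<b}. f (x + c) \<partial>lborel)"
    by (intro nn_integral_cong) (auto simp: indicator_def)
  finally show ?thesis ..
qed

lemma nn_integral_Ico_split:
  fixes f :: "real \<Rightarrow> ennreal"
  assumes [measurable]: "f \<in> borel_measurable borel" and "a \<le> b" "b \<le> c"
  shows "(\<integral>\<^sup>+x\<in>{a..<c}. f x \<partial>lborel) = (\<integral>\<^sup>+x\<in>{a..<b}. f x \<partial>lborel) + (\<integral>\<^sup>+x\<in>{b..<c}. f x \<partial>lborel)"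
proof -
  have "{a..<c} = {a..<b} \<union> {b..<c}" using assms by auto
  then show ?thesis by (simp add: nn_integral_disjoint_pair)
qed

text \<open>After reducing \<open>c\<close> modulo \<open>T\<close> to \<open>e\<close>, the piece
  \<open>{T..<e + T}\<close> moves back by one period and fills \<open>{0..<e}\<close>.\<close>

lemma nn_integral_periodic:
  fixes f :: "real \<Rightarrow> ennreal"
  assumes [measurable]: "f \<in> borel_measurable borel"
    and T: "T > 0" and per: "\<And>x. f (x + T) = f x"
  shows "(\<integral>\<^sup>+x\<in>{c..<c + T}. f x \<partial>lborel) = (\<integral>\<^sup>+x\<in>{0..<T}. f x \<partial>lborel)"
proof -
  interpret periodic_fun_simple f T by standard (rule per)
  define n where "n = \<lfloor>c / T\<rfloor>"
  define e where "e = c - of_int n * T"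
  have "of_int n \<le> c / T" "c / T < of_int n + 1" by (auto simp: n_def)
  then have e: "0 \<le> e" "e < T" using T by (auto simp: e_def field_simps)
  have "(\<integral>\<^sup>+x\<in>{c..<c + T}. f x \<partial>lborel) = (\<integral>\<^sup>+x\<in>{e..<e + T}. f (x + of_int n * T) \<partial>lborel)"
    by (subst nn_integral_translate_Ico) (auto simp: e_def algebra_simps)
  also have "\<dots> = (\<integral>\<^sup>+x\<in>{e..<e + T}. f x \<partial>lborel)" by (simp add: plus_of_int)
  also have "\<dots> = (\<integral>\<^sup>+x\<in>{e..<T}. f x \<partial>lborel) + (\<integral>\<^sup>+x\<in>{T..<e + T}. f x \<partial>lborel)"
    using e by (intro nn_integral_Ico_split) auto
  also have "(\<integral>\<^sup>+x\<in>{T..<e + T}. f x \<partial>lborel) = (\<integral>\<^sup>+x\<in>{0..<e}. f x \<partial>lborel)"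
    using nn_integral_translate_Ico[OF assms(1), of T 0 e] by (simp add: per)
  also have "(\<integral>\<^sup>+x\<in>{e..<T}. f x \<partial>lborel) + (\<integral>\<^sup>+x\<in>{0..<e}. f x \<partial>lborel) = (\<integral>\<^sup>+x\<in>{0..<T}. f x \<partial>lborel)"
    using e by (subst nn_integral_Ico_split[of f 0 e T]) (auto simp: add.commute)
  finally show ?thesis .
qed

lemma nn_integral_periodic_translate:
  fixes f :: "real \<Rightarrow> ennreal"
  assumes "f \<in> borel_measurable borel" "T > 0" "\<And>x. f (x + T) = f x"
  shows "(\<integral>\<^sup>+x\<in>{0..<T}. f (x + r) \<partial>lborel) = (\<integral>\<^sup>+x\<in>{0..<T}. f x \<partial>lborel)"
  using nn_integral_translate_Ico[OF assms(1), of r 0 T] nn_integral_periodic[OF assms, of r]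
  by (simp add: add.commute)

section \<open>Reduction of the energy to increments\<close>

definition increment_energy :: "real \<Rightarrow> (real \<Rightarrow> real) \<Rightarrow> real \<Rightarrow> ennreal" where
  "increment_energy T u h = (\<integral>\<^sup>+x\<in>{0..<T}. ennreal ((u (x + h) - u x)\<^sup>2) \<partial>lborel)"

lemma increment_energy_measurable [measurable]:
  assumes [measurable]: "u \<in> borel_measurable borel"
  shows "increment_energy T u \<in> borel_measurable borel"
  unfolding increment_energy_def by measurable

text \<open>Translating by \<open>h\<close> over a full period exchanges the two end points of the
  increment. The later comparison thus reduces to \<open>h > 0\<close>.\<close>

lemma increment_energy_uminus:
  assumes [measurable]: "u \<in> borel_measurable borel" and "T > 0" "\<And>x. u (x + T) = u x"
  shows "increment_energy T u (- h) = increment_energy T u h"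
proof -
  have "increment_energy T u (- h) = (\<integral>\<^sup>+x\<in>{0..<T}. ennreal ((u ((x + h) + - h) - u (x + h))\<^sup>2) \<partial>lborel)"
    unfolding increment_energy_def
  proof (rule nn_integral_periodic_translate[symmetric, where f="\<lambda>x. ennreal ((u (x + - h) - u x)\<^sup>2)"])
    fix x
    have "x + T + - h = (x + - h) + T" by simp
    then show "ennreal ((u (x + T + - h) - u (x + T))\<^sup>2) = ennreal ((u (x + - h) - u x)\<^sup>2)"
      using assms(3) by metis
  qed (use \<open>T > 0\<close> in auto)
  also have "\<dots> = increment_energy T u h"
    unfolding increment_energy_def by (simp add: power2_commute)
  finally show ?thesis .
qed

text \<open>Tonelli's theorem after substituting \<open>y = x + h\<close>: the kernel depends on
  \<open>h\<close> alone and leaves the inner integral.\<close>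

lemma F_s_eq_increment_energy:
  assumes [measurable]: "u \<in> borel_measurable borel"
  shows "F_s T s u = ennreal (1 / (2 * T)) *
    (\<integral>\<^sup>+h. ennreal (1 / \<bar>h\<bar> powr (1 + 2 * s)) * increment_energy T u h \<partial>lborel)"
proof -
  let ?K = "\<lambda>x y. ennreal (\<bar>u x - u y\<bar>\<^sup>2 / \<bar>x - y\<bar> powr (1 + 2 * s))"
  have "(\<integral>\<^sup>+ x \<in> {0..T}. (\<integral>\<^sup>+ y. ?K x y \<partial>lborel) \<partial>lborel) =
        (\<integral>\<^sup>+ x \<in> {0..<T}. (\<integral>\<^sup>+ y. ?K x y \<partial>lborel) \<partial>lborel)"
  proof (rule nn_integral_cong_AE)
    show "AE x in lborel. (\<integral>\<^sup>+ y. ?K x y \<partial>lborel) * indicator {0..T} x =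
            (\<integral>\<^sup>+ y. ?K x y \<partial>lborel) * indicator {0..<T} x"
      using AE_lborel_singleton[of T] by eventually_elim (auto simp: indicator_def)
  qed
  also have "\<dots> = (\<integral>\<^sup>+ x. (\<integral>\<^sup>+ h. ?K x (h + x) * indicator {0..<T} x \<partial>lborel) \<partial>lborel)"
    
  proof (rule nn_integral_cong)
    fix x
    show "(\<integral>\<^sup>+ y. ?K x y \<partial>lborel) * indicator {0..<T} x = (\<integral>\<^sup>+ h. ?K x (h + x) * indicator {0..<T} x \<partial>lborel)"
      by (subst nn_integral_translate[of "?K x" x, symmetric]) (auto simp: nn_integral_multc)
  qed
  also have "\<dots> = (\<integral>\<^sup>+ h. (\<integral>\<^sup>+ x. ?K x (h + x) * indicator {0..<T} x \<partial>lborel) \<partial>lborel)"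
    by (subst lborel_pair.Fubini') auto
  also have "\<dots> = (\<integral>\<^sup>+h. ennreal (1 / \<bar>h\<bar> powr (1 + 2 * s)) * increment_energy T u h \<partial>lborel)"
    unfolding increment_energy_def
    by (subst nn_integral_cmult[symmetric])
       (auto intro!: nn_integral_cong simp: ennreal_mult[symmetric] mult.assoc[symmetric] power2_commute add.commute)
  finally show ?thesis unfolding F_s_def by simp
qed

section \<open>Drop sequences\<close>

text \<open>Indexing the drops by all integers in increasing order turns periodicity into an index
  shift by \<open>L\<close>. By \<open>T_eq\<close> the mean gap is
  \<open>(\<Lambda> + 1) * \<delta>\<close>.\<close>

locale drop_sequence =
  fixes \<Lambda> \<delta> T :: real and L :: nat and a :: "int \<Rightarrow> real"
  assumes Lambda_pos: "\<Lambda> > 0" and delta_pos: "\<delta> > 0" and L_pos: "L \<ge> 1"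
    and T_eq: "T = real L * (\<Lambda> + 1) * \<delta>"
    and gap: "a k + \<delta> \<le> a (k + 1)"
    and per: "a (k + int L) = a k + T"
begin

lemma T_pos: "T > 0"
  using Lambda_pos delta_pos L_pos by (simp add: T_eq)

lemma gaps: "0 \<le> m \<Longrightarrow> a k + of_int m * \<delta> \<le> a (k + m)"
proof (induction m rule: int_ge_induct)
  case (step m)
  then show ?case using gap[of "k + m"] by (simp add: algebra_simps)
qed simp

lemma gap_less:
  assumes "i < j"
  shows "a i + \<delta> \<le> a j"
proof -
  have "1 * \<delta> \<le> of_int (j - i) * \<delta>"
    using assms delta_pos by (intro mult_right_mono) linarith+
  then show ?thesis using gaps[of "j - i" i] assms by simp
qed

text \<open>Raising \<open>m\<close> by one removes \<open>a m\<close> and adds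
  \<open>a (m + int L) = a m + T\<close>. Hence the sum of the gaps of index distance
  \<open>m\<close> over one period does not depend on the sequence.\<close>

lemma sum_shift: "(\<Sum>i<L. a (int i + m)) = (\<Sum>i<L. a (int i)) + of_int m * T"
proof -
  have step: "(\<Sum>i<L. a (int i + (m + 1))) = (\<Sum>i<L. a (int i + m)) + T" for m
  proof -
    have "(\<Sum>i<Suc L. a (int i + m)) = a m + (\<Sum>i<L. a (int i + (m + 1)))"
      by (subst sum.lessThan_Suc_shift) (simp add: algebra_simps)
    then show ?thesis using per[of m] by (simp add: add.commute)
  qed
  show ?thesis
  proof (induction m rule: int_induct[where k = 0])
    case base
    show ?case by simp
  next
    case (step1 m)
    then show ?case unfolding step by (simp add: distrib_right)
  next
    case (step2 m)
    then have "(\<Sum>i<L. a (int i + (m - 1))) + T = (\<Sum>i<L. a (int i)) + of_int m * T"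
      using step[of "m - 1"] by simp
    then show ?case by (simp add: left_diff_distrib)
  qed
qed

definition drops :: "real set" where
  "drops = (\<Union>k. {a k..<a k + \<delta>})"

lemma drops_measurable [measurable]: "drops \<in> sets borel"
  unfolding drops_def by measurable

lemma in_drops_unique: "y \<in> {a i..<a i + \<delta>} \<Longrightarrow> y \<in> {a j..<a j + \<delta>} \<Longrightarrow> i = j"
  using gap_less[of i j] gap_less[of j i] by (cases i j rule: linorder_cases) auto

text \<open>The sum over drops is taken as a counting-measure integral so that it can be exchanged
  with Lebesgue integrals.\<close>

lemma indicator_drops:
  "(indicator drops y :: ennreal) = (\<integral>\<^sup>+k. indicator {a k..<a k + \<delta>} y \<partial>count_space UNIV)"
proof (cases "y \<in> drops")
  case True
  then obtain k where k: "y \<in> {a k..<a k + \<delta>}" by (auto simp: drops_def)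
  have "(\<integral>\<^sup>+k. indicator {a k..<a k + \<delta>} y \<partial>count_space UNIV) = (\<Sum>j\<in>{k}. indicator {a j..<a j + \<delta>} y)"
    using in_drops_unique[OF k] by (intro nn_integral_count_space') (auto simp: indicator_def)
  then show ?thesis using k True by simp
next
  case False
  then have "y \<notin> {a k..<a k + \<delta>}" for k by (auto simp: drops_def)
  then have "(\<integral>\<^sup>+k. indicator {a k..<a k + \<delta>} y \<partial>count_space UNIV) = (\<integral>\<^sup>+(k::int). 0 \<partial>count_space UNIV)"
    by (intro nn_integral_cong) (auto simp: indicator_def)
  with False show ?thesis by simp
qed

lemma drops_periodic: "y + T \<in> drops \<longleftrightarrow> y \<in> drops"
proof
  assume "y \<in> drops"
  then obtain k where "y \<in> {a k..<a k + \<delta>}" by (auto simp: drops_def)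
  then have "y + T \<in> {a (k + int L)..<a (k + int L) + \<delta>}" by (simp add: per)
  then show "y + T \<in> drops" unfolding drops_def by blast
next
  assume "y + T \<in> drops"
  then obtain k where "y + T \<in> {a k..<a k + \<delta>}" by (auto simp: drops_def)
  then have "y \<in> {a (k - int L)..<a (k - int L) + \<delta>}" using per[of "k - int L"] by simp
  then show "y \<in> drops" unfolding drops_def by blast
qed

text \<open>A period that begins at \<open>a 0\<close> ends where drop \<open>L\<close> starts, so
  it cuts no drop.\<close>

lemma indicator_drops_period:
  "(indicator drops y * indicator {a 0..<a 0 + T} y :: ennreal) = (\<Sum>i<L. indicator {a (int i)..<a (int i) + \<delta>} y)"
proof (cases "\<exists>i<L. y \<in> {a (int i)..<a (int i) + \<delta>}")
  case True
  then obtain i where i: "i < L" "y \<in> {a (int i)..<a (int i) + \<delta>}" by blast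
  have "a 0 \<le> a (int i)" using gap_less[of 0 "int i"] delta_pos by (cases "i = 0") auto
  moreover have "a (int i) + \<delta> \<le> a 0 + T" using gap_less[of "int i" "int L"] i per[of 0] by simp
  ultimately have "y \<in> {a 0..<a 0 + T}" using i by auto
  moreover have "y \<in> drops" using i by (auto simp: drops_def)
  moreover have "(\<Sum>j<L. indicator {a (int j)..<a (int j) + \<delta>} y :: ennreal) = (\<Sum>j<L. if j = i then 1 else 0)"
  proof (rule sum.cong)
    fix j
    show "(indicator {a (int j)..<a (int j) + \<delta>} y :: ennreal) = (if j = i then 1 else 0)"
      using in_drops_unique[OF i(2), of "int j"] i(2) by (cases "j = i") (auto split: split_indicator)
  qed simp
  ultimately show ?thesis using i by simp
next
  case False
  have "y \<notin> drops \<or> y \<notin> {a 0..<a 0 + T}"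
  proof (rule ccontr)
    assume "\<not> ?thesis"
    then obtain k where k: "y \<in> {a k..<a k + \<delta>}" and y: "a 0 \<le> y" "y < a 0 + T" by (auto simp: drops_def)
    have "\<not> k < 0" using gap_less[of k 0] k y(1) by auto
    moreover have "\<not> int L < k" "k \<noteq> int L"
      using per[of 0] gap_less[of "int L" k] k y(2) delta_pos by auto
    ultimately have "nat k < L" "int (nat k) = k" by auto
    then show False using False k by metis
  qed
  then have "(indicator drops y * indicator {a 0..<a 0 + T} y :: ennreal) = 0"
    by (auto split: split_indicator)
  moreover have "(\<Sum>i<L. indicator {a (int i)..<a (int i) + \<delta>} y :: ennreal) = 0"
    using False by (intro sum.neutral) (auto split: split_indicator)
  ultimately show ?thesis by simp
qed

section \<open>Squared window measures as sums over pairs of drops\<close>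

definition window :: "real \<Rightarrow> real \<Rightarrow> real" where
  "window h x = measure lborel (drops \<inter> {x..x + h})"

lemma emeasure_window: "emeasure lborel (drops \<inter> {x..x + h}) = ennreal (window h x)"
proof -
  have "emeasure lborel (drops \<inter> {x..x + h}) \<le> emeasure lborel {x..x + h}"
    by (intro emeasure_mono) auto
  also have "\<dots> < \<infinity>" by (simp add: emeasure_lborel_Icc_eq)
  finally show ?thesis unfolding window_def by (intro emeasure_eq_ennreal_measure) auto
qed

text \<open>In terms of the offset \<open>r\<close> the window is the fixed interval
  \<open>{0..h}\<close>, so that in the square only the factors for \<open>drops\<close> depend on
  \<open>x\<close>.\<close>

lemma window_nn_integral:
  "ennreal (window h x) = (\<integral>\<^sup>+r. indicator drops (x + r) * indicator {0..h} r \<partial>lborel)"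
proof -
  have "ennreal (window h x) = (\<integral>\<^sup>+r. indicator (drops \<inter> {x..x + h}) r \<partial>lborel)"
    by (simp add: emeasure_window)
  also have "\<dots> = (\<integral>\<^sup>+r. indicator (drops \<inter> {x..x + h}) (r + x) \<partial>lborel)"
    by (rule nn_integral_translate[symmetric]) measurable
  also have "\<dots> = (\<integral>\<^sup>+r. indicator drops (x + r) * indicator {0..h} r \<partial>lborel)"
    by (intro nn_integral_cong) (auto simp: indicator_def add.commute)
  finally show ?thesis .
qed

end

text \<open>For \<open>h > 0\<close> this is the measure of the set of \<open>x\<close> for which
  \<open>{x..x + h}\<close> contains two given points at signed distance \<open>t\<close>. It is
  convex on each side of \<open>t = 0\<close> but not across, which is why the signs of the gaps
  matter below.\<close>

definition overlap :: "real \<Rightarrow> real \<Rightarrow> real" where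
  "overlap h t = max 0 (h - \<bar>t\<bar>)"

lemma overlap_measurable [measurable]: "overlap h \<in> borel_measurable borel"
  unfolding overlap_def by measurable

lemma overlap_nonneg: "0 \<le> overlap h t"
  by (simp add: overlap_def)

lemma nn_integral_overlap:
  assumes "h > 0"
  shows "(\<integral>\<^sup>+r. indicator {0..h} r * indicator {0..h} (r + t) \<partial>lborel) = ennreal (overlap h t)"
proof -
  have "(\<integral>\<^sup>+r. indicator {0..h} r * indicator {0..h} (r + t) \<partial>lborel) =
        (\<integral>\<^sup>+r. indicator {max 0 (-t)..min h (h - t)} r \<partial>lborel)"
    by (intro nn_integral_cong) (auto simp: indicator_def)
  also have "\<dots> = ennreal (overlap h t)"
    using assms by (auto simp: overlap_def emeasure_lborel_Icc_eq min_def max_def abs_if)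
  finally show ?thesis .
qed

context drop_sequence
begin

text \<open>Here \<open>m\<close> is the index distance of two drops, and \<open>t\<close> stands
  for the difference \<open>w - v\<close> of offsets within them.\<close>

definition overlap_sum :: "real \<Rightarrow> int \<Rightarrow> real \<Rightarrow> real" where
  "overlap_sum h m t = (\<Sum>i<L. overlap h (a (int i + m) - a (int i) + t))"

lemma overlap_sum_measurable [measurable]: "overlap_sum h m \<in> borel_measurable borel"
  unfolding overlap_sum_def by measurable

lemma nn_integral_drops_overlap:
  "(\<integral>\<^sup>+t. indicator drops (y + t) * ennreal (overlap h t) \<partial>lborel) =
   (\<integral>\<^sup>+k. (\<integral>\<^sup>+w\<in>{0..<\<delta>}. ennreal (overlap h (a k + w - y)) \<partial>lborel) \<partial>count_space UNIV)"
proof -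
  have "(\<integral>\<^sup>+t. indicator drops (y + t) * ennreal (overlap h t) \<partial>lborel) =
        (\<integral>\<^sup>+z. indicator drops (y + (z + - y)) * ennreal (overlap h (z + - y)) \<partial>lborel)"
    by (rule nn_integral_translate[symmetric]) measurable
  also have "\<dots> = (\<integral>\<^sup>+z. (\<integral>\<^sup>+k. ennreal (overlap h (z - y)) * indicator {a k..<a k + \<delta>} z \<partial>count_space UNIV) \<partial>lborel)"
    by (simp add: nn_integral_cmult indicator_drops mult.commute)
  also have "\<dots> = (\<integral>\<^sup>+k. (\<integral>\<^sup>+z\<in>{a k..<a k + \<delta>}. ennreal (overlap h (z - y)) \<partial>lborel) \<partial>count_space UNIV)"
    by (intro nn_integral_count_space_nn_integral) auto
  also have "\<dots> = (\<integral>\<^sup>+k. (\<integral>\<^sup>+w\<in>{0..<\<delta>}. ennreal (overlap h (a k + w - y)) \<partial>lborel) \<partial>count_space UNIV)"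
  proof (rule nn_integral_cong)
    fix k
    show "(\<integral>\<^sup>+z\<in>{a k..<a k + \<delta>}. ennreal (overlap h (z - y)) \<partial>lborel) =
      (\<integral>\<^sup>+w\<in>{0..<\<delta>}. ennreal (overlap h (a k + w - y)) \<partial>lborel)"
      using nn_integral_translate_Ico[of "\<lambda>z. ennreal (overlap h (z - y))" "a k" 0 \<delta>]
      by (simp add: add.commute)
  qed
  finally show ?thesis .
qed

definition window_energy :: "real \<Rightarrow> ennreal" where
  "window_energy h = (\<integral>\<^sup>+x\<in>{0..<T}. ennreal ((window h x)\<^sup>2) \<partial>lborel)"

text \<open>The square of a window measure is an integral over pairs of points of
  \<open>drops\<close> that lie in the window. Integrating out the position of the window leaves the
  \<open>overlap\<close> of their distance; the pairs are then sorted by the index \<open>i\<close>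
  of the first drop and the index distance \<open>m\<close>.\<close>

lemma window_energy_eq:
  assumes h: "h > 0"
  shows "window_energy h =
    (\<integral>\<^sup>+m. (\<integral>\<^sup>+v\<in>{0..<\<delta>}. (\<integral>\<^sup>+w\<in>{0..<\<delta>}. ennreal (overlap_sum h m (w - v)) \<partial>lborel) \<partial>lborel) \<partial>count_space UNIV)"
proof -
  let ?D = "indicator drops :: real \<Rightarrow> ennreal"
  let ?I = "indicator {0..h} :: real \<Rightarrow> ennreal"
  let ?P = "indicator {0..<T} :: real \<Rightarrow> ennreal"
  let ?c = "\<lambda>t. \<integral>\<^sup>+y\<in>{a 0..<a 0 + T}. ?D y * ?D (y + t) \<partial>lborel"
  let ?g = "\<lambda>i m v w. ennreal (overlap h (a (int i + m) - a (int i) + (w - v))) *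
    indicator {0..<\<delta>} w * indicator {0..<\<delta>} v"
  have D_per: "?D (y + T) = ?D y" for y
    by (simp add: indicator_def drops_periodic)
  have D_per': "?D (x + T + y) = ?D (x + y)" for x y
    using D_per[of "x + y"] by (simp add: add.assoc add.commute[of y])
  \<comment> \<open>The two points are \<open>x + r\<close> and \<open>x + r + t\<close>: the second
    offset is translated by \<open>r\<close> so that \<open>t\<close> is the difference.\<close>
  have sq: "ennreal ((window h x)\<^sup>2) = (\<integral>\<^sup>+r. (\<integral>\<^sup>+t. ?D (x + r) * ?D (x + r + t) * (?I r * ?I (r + t)) \<partial>lborel) \<partial>lborel)" for x
  proof -
    have "ennreal ((window h x)\<^sup>2) = ennreal (window h x) * ennreal (window h x)"
      by (simp add: power2_eq_square ennreal_mult window_def)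
    also have "\<dots> = (\<integral>\<^sup>+r. (?D (x + r) * ?I r) * ennreal (window h x) \<partial>lborel)"
      by (subst nn_integral_multc) (auto simp: window_nn_integral)
    also have "\<dots> = (\<integral>\<^sup>+r. (?D (x + r) * ?I r) * (\<integral>\<^sup>+t. ?D (x + (t + r)) * ?I (t + r) \<partial>lborel) \<partial>lborel)"
      unfolding window_nn_integral
      by (subst nn_integral_translate) auto
    also have "\<dots> = (\<integral>\<^sup>+r. (\<integral>\<^sup>+t. ?D (x + r) * ?D (x + r + t) * (?I r * ?I (r + t)) \<partial>lborel) \<partial>lborel)"
      by (subst nn_integral_cmult[symmetric]) (auto intro!: nn_integral_cong simp: ac_simps)
    finally show ?thesis .
  qed
  have "window_energy h = (\<integral>\<^sup>+x. (\<integral>\<^sup>+r. (\<integral>\<^sup>+t. ?D (x + r) * ?D (x + r + t) * (?I r * ?I (r + t)) * ?P x \<partial>lborel) \<partial>lborel) \<partial>lborel)"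
    unfolding window_energy_def sq by (simp add: nn_integral_multc)
  also have "\<dots> = (\<integral>\<^sup>+r. (\<integral>\<^sup>+x. (\<integral>\<^sup>+t. ?D (x + r) * ?D (x + r + t) * (?I r * ?I (r + t)) * ?P x \<partial>lborel) \<partial>lborel) \<partial>lborel)"
    by (intro lborel_pair.Fubini') measurable
  also have "\<dots> = (\<integral>\<^sup>+r. (\<integral>\<^sup>+t. (\<integral>\<^sup>+x. ?D (x + r) * ?D (x + r + t) * (?I r * ?I (r + t)) * ?P x \<partial>lborel) \<partial>lborel) \<partial>lborel)"
    by (intro nn_integral_cong lborel_pair.Fubini') measurable
  also have "\<dots> = (\<integral>\<^sup>+r. (\<integral>\<^sup>+t. ?I r * ?I (r + t) * ?c t \<partial>lborel) \<partial>lborel)"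
  proof (intro nn_integral_cong)
    fix r t
    have "(\<integral>\<^sup>+x. ?D (x + r) * ?D (x + r + t) * (?I r * ?I (r + t)) * ?P x \<partial>lborel) =
          ?I r * ?I (r + t) * (\<integral>\<^sup>+x. ?D (x + r) * ?D (x + r + t) * ?P x \<partial>lborel)"
      by (subst nn_integral_cmult[symmetric]) (auto intro!: nn_integral_cong simp: ac_simps)
    \<comment> \<open>Periodicity first removes the shift by \<open>r\<close>, then moves the period
      to start at \<open>a 0\<close>, where it cuts no drop.\<close>
    also have "(\<integral>\<^sup>+x. ?D (x + r) * ?D (x + r + t) * ?P x \<partial>lborel) = ?c t"
      using nn_integral_periodic_translate[of "\<lambda>y. ?D y * ?D (y + t)" T r]
        nn_integral_periodic[of "\<lambda>y. ?D y * ?D (y + t)" T "a 0"]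
      by (simp add: T_pos D_per D_per')
    finally show "(\<integral>\<^sup>+x. ?D (x + r) * ?D (x + r + t) * (?I r * ?I (r + t)) * ?P x \<partial>lborel) = ?I r * ?I (r + t) * ?c t" .
  qed
  also have "\<dots> = (\<integral>\<^sup>+t. (\<integral>\<^sup>+r. ?I r * ?I (r + t) * ?c t \<partial>lborel) \<partial>lborel)"
    by (intro lborel_pair.Fubini') measurable
  also have "\<dots> = (\<integral>\<^sup>+t. (\<integral>\<^sup>+y. ?D y * indicator {a 0..<a 0 + T} y * (?D (y + t) * ennreal (overlap h t)) \<partial>lborel) \<partial>lborel)"
    by (simp add: nn_integral_multc nn_integral_overlap[OF h])
       (auto intro!: nn_integral_cong simp: nn_integral_cmult[symmetric] ac_simps)
  also have "\<dots> = (\<integral>\<^sup>+y. (\<integral>\<^sup>+t. ?D y * indicator {a 0..<a 0 + T} y * (?D (y + t) * ennreal (overlap h t)) \<partial>lborel) \<partial>lborel)"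
    by (intro lborel_pair.Fubini') measurable
  also have "\<dots> = (\<integral>\<^sup>+y. ?D y * indicator {a 0..<a 0 + T} y * (\<integral>\<^sup>+t. ?D (y + t) * ennreal (overlap h t) \<partial>lborel) \<partial>lborel)"
    by (intro nn_integral_cong nn_integral_cmult) auto
  also have "\<dots> = (\<Sum>i<L. (\<integral>\<^sup>+y\<in>{a (int i)..<a (int i) + \<delta>}. (\<integral>\<^sup>+t. ?D (y + t) * ennreal (overlap h t) \<partial>lborel) \<partial>lborel))"
    unfolding indicator_drops_period sum_distrib_right
    by (subst nn_integral_sum) (auto simp: mult.commute)
  also have "\<dots> = (\<Sum>i<L. (\<integral>\<^sup>+v\<in>{0..<\<delta>}. (\<integral>\<^sup>+t. ?D (v + a (int i) + t) * ennreal (overlap h t) \<partial>lborel) \<partial>lborel))"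
  proof (intro sum.cong refl)
    fix i
    show "(\<integral>\<^sup>+y\<in>{a (int i)..<a (int i) + \<delta>}. (\<integral>\<^sup>+t. ?D (y + t) * ennreal (overlap h t) \<partial>lborel) \<partial>lborel) =
      (\<integral>\<^sup>+v\<in>{0..<\<delta>}. (\<integral>\<^sup>+t. ?D (v + a (int i) + t) * ennreal (overlap h t) \<partial>lborel) \<partial>lborel)"
      by (subst nn_integral_translate_Ico) (auto simp: add.commute)
  qed
  also have "\<dots> = (\<Sum>i<L. (\<integral>\<^sup>+v. (\<integral>\<^sup>+m. (\<integral>\<^sup>+w. ?g i m v w \<partial>lborel) \<partial>count_space UNIV) \<partial>lborel))"
  proof (intro sum.cong refl nn_integral_cong)
    fix i v
    let ?f = "\<lambda>k. \<integral>\<^sup>+w\<in>{0..<\<delta>}. ennreal (overlap h (a k + w - (v + a (int i)))) \<partial>lborel"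
    \<comment> \<open>Writing \<open>k = i + m\<close> replaces the index of the second drop by its
      index distance from the first.\<close>
    have "bij_betw ((+) (int i)) UNIV UNIV"
      by (intro bij_betwI[where g="\<lambda>k. k - int i"]) auto
    then have "(\<integral>\<^sup>+k. ?f k \<partial>count_space UNIV) = (\<integral>\<^sup>+m. ?f (int i + m) \<partial>count_space UNIV)"
      by (rule nn_integral_bij_count_space[symmetric])
    then show "(\<integral>\<^sup>+t. ?D (v + a (int i) + t) * ennreal (overlap h t) \<partial>lborel) * indicator {0..<\<delta>} v =
       (\<integral>\<^sup>+m. (\<integral>\<^sup>+w. ?g i m v w \<partial>lborel) \<partial>count_space UNIV)"
      unfolding nn_integral_drops_overlap
      by (auto simp: indicator_def algebra_simps)
  qed
  also have "\<dots> = (\<Sum>i<L. (\<integral>\<^sup>+m. (\<integral>\<^sup>+v. (\<integral>\<^sup>+w. ?g i m v w \<partial>lborel) \<partial>lborel) \<partial>count_space UNIV))"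
    by (intro sum.cong refl nn_integral_count_space_nn_integral) auto
  also have "\<dots> = (\<integral>\<^sup>+m. (\<Sum>i<L. (\<integral>\<^sup>+v. (\<integral>\<^sup>+w. ?g i m v w \<partial>lborel) \<partial>lborel)) \<partial>count_space UNIV)"
    by (rule nn_integral_sum[symmetric]) auto
  also have "\<dots> = (\<integral>\<^sup>+m. (\<integral>\<^sup>+v. (\<Sum>i<L. (\<integral>\<^sup>+w. ?g i m v w \<partial>lborel)) \<partial>lborel) \<partial>count_space UNIV)"
    by (intro nn_integral_cong nn_integral_sum[symmetric]) auto
  also have "\<dots> = (\<integral>\<^sup>+m. (\<integral>\<^sup>+v. (\<integral>\<^sup>+w. (\<Sum>i<L. ?g i m v w) \<partial>lborel) \<partial>lborel) \<partial>count_space UNIV)"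
    by (intro nn_integral_cong nn_integral_sum[symmetric]) auto
  also have "\<dots> = (\<integral>\<^sup>+m. (\<integral>\<^sup>+v. (\<integral>\<^sup>+w. ennreal (overlap_sum h m (w - v)) * indicator {0..<\<delta>} w * indicator {0..<\<delta>} v \<partial>lborel) \<partial>lborel) \<partial>count_space UNIV)"
  proof (intro nn_integral_cong)
    fix m v w
    have "(\<Sum>i<L. ennreal (overlap h (a (int i + m) - a (int i) + (w - v)))) = ennreal (overlap_sum h m (w - v))"
      unfolding overlap_sum_def by (rule sum_ennreal) (rule overlap_nonneg)
    then show "(\<Sum>i<L. ?g i m v w) =
      ennreal (overlap_sum h m (w - v)) * indicator {0..<\<delta>} w * indicator {0..<\<delta>} v"
      unfolding sum_distrib_right[symmetric] by (rule arg_cong)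
  qed
  also have "\<dots> = (\<integral>\<^sup>+m. (\<integral>\<^sup>+v\<in>{0..<\<delta>}. (\<integral>\<^sup>+w\<in>{0..<\<delta>}. ennreal (overlap_sum h m (w - v)) \<partial>lborel) \<partial>lborel) \<partial>count_space UNIV)"
  proof (rule nn_integral_cong, rule nn_integral_cong)
    fix m v
    show "(\<integral>\<^sup>+w. ennreal (overlap_sum h m (w - v)) * indicator {0..<\<delta>} w * indicator {0..<\<delta>} v \<partial>lborel) =
      (\<integral>\<^sup>+w\<in>{0..<\<delta>}. ennreal (overlap_sum h m (w - v)) \<partial>lborel) * indicator {0..<\<delta>} v"
      by (rule nn_integral_multc) measurable
  qed
  finally show ?thesis .
qed

end

section \<open>Optimality of equal gaps\<close>

text \<open>A nonempty open interval is not null. Below, this turns strictness on an interval into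
  the failure of the reverse inequality almost everywhere, as \<open>nn_integral_less\<close>
  requires.\<close>

lemma AE_lborel_in_Ioo:
  fixes a b :: real
  assumes "AE x in lborel. P x" and "a < b"
  obtains x where "a < x" "x < b" "P x"
proof -
  have "\<exists>x\<in>{a<..<b}. P x"
  proof (rule ccontr)
    assume "\<not> ?thesis"
    with assms(1) have "AE x in lborel. x \<notin> {a<..<b}" by (auto elim: eventually_mono)
    then have "emeasure lborel {a<..<b} = 0"
      by (subst (asm) AE_iff_measurable[where N="{a<..<b}"]) auto
    with \<open>a < b\<close> show False by simp
  qed
  then show ?thesis using that by auto
qed

text \<open>Jensen's inequality for the positive part, without normalization.\<close>

lemma max_0_sum_le: "max 0 (\<Sum>i\<in>A. f i) \<le> (\<Sum>i\<in>A. max 0 (f i))" for f :: "'b \<Rightarrow> real"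
  by (auto intro!: sum_nonneg sum_mono)

text \<open>A positive term makes the right side positive, and a negative term makes it exceed the
  plain sum.\<close>

lemma max_0_sum_less:
  fixes f :: "'b \<Rightarrow> real"
  assumes "finite A" "i \<in> A" "j \<in> A" "f i > 0" "f j < 0"
  shows "max 0 (\<Sum>k\<in>A. f k) < (\<Sum>k\<in>A. max 0 (f k))"
proof -
  have "0 < (\<Sum>k\<in>A. max 0 (f k))"
    using assms by (intro sum_pos2[of A i]) auto
  moreover have "(\<Sum>k\<in>A. f k) < (\<Sum>k\<in>A. max 0 (f k))"
    using assms by (intro sum_strict_mono_ex1 bexI[of _ j]) auto
  ultimately show ?thesis by simp
qed

context drop_sequence
begin

abbreviation spacing :: real where "spacing \<equiv> (\<Lambda> + 1) * \<delta>"

lemma sum_gaps: "(\<Sum>i<L. a (int i + m) - a (int i)) = real L * (of_int m * spacing)"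
  by (simp add: sum_subtractf sum_shift T_eq)

text \<open>For \<open>m \<noteq> 0\<close> distinct drops start at least \<delta> apart, which
  dominates \<open>t\<close>, so the shifted gaps share one sign. Jensen then applies to terms
  affine in the gaps, whose sum is fixed. For \<open>m = 0\<close> all gaps vanish and both sides
  agree.\<close>

lemma overlap_sum_ge:
  assumes "\<bar>t\<bar> \<le> \<delta>"
  shows "real L * overlap h (of_int m * spacing + t) \<le> overlap_sum h m t"
proof -
  \<comment> \<open>The common sign \<sigma> of the shifted gaps makes their absolute values linear,
    so that they can be summed.\<close>
  have *: "real L * overlap h (of_int m * spacing + t) \<le> overlap_sum h m t"
    if \<sigma>: "\<sigma> \<in> {-1, 1}" and eq: "\<And>i. \<bar>a (int i + m) - a (int i) + t\<bar> = \<sigma> * (a (int i + m) - a (int i) + t)"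
    for \<sigma>
  proof -
    have "(\<Sum>i<L. \<sigma> * (a (int i + m) - a (int i) + t)) = \<sigma> * (real L * (of_int m * spacing + t))"
      unfolding sum_distrib_left[symmetric] sum.distrib sum_gaps by (simp add: distrib_left)
    also have "\<dots> = real L * (\<sigma> * (of_int m * spacing + t))" by simp
    finally have s: "(\<Sum>i<L. \<sigma> * (a (int i + m) - a (int i) + t)) = real L * (\<sigma> * (of_int m * spacing + t))" .
    have "0 \<le> (\<Sum>i<L. \<sigma> * (a (int i + m) - a (int i) + t))"
      using eq by (intro sum_nonneg) (metis abs_ge_zero)
    then have "0 \<le> \<sigma> * (of_int m * spacing + t)"
      unfolding s using L_pos by (simp add: zero_le_mult_iff)
    then have abs: "\<bar>of_int m * spacing + t\<bar> = \<sigma> * (of_int m * spacing + t)"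
      using \<sigma> by auto
    have "real L * overlap h (of_int m * spacing + t) =
      max 0 (\<Sum>i<L. h - \<sigma> * (a (int i + m) - a (int i) + t))"
      unfolding overlap_def abs sum_subtractf s
      by (simp add: max_mult_distrib_left right_diff_distrib)
    also have "\<dots> \<le> (\<Sum>i<L. max 0 (h - \<sigma> * (a (int i + m) - a (int i) + t)))"
      by (rule max_0_sum_le)
    also have "\<dots> = overlap_sum h m t" by (simp add: overlap_sum_def overlap_def eq)
    finally show ?thesis .
  qed
  consider "m = 0" | "m > 0" | "m < 0" by linarith
  then show ?thesis
  proof cases
    case 1
    then show ?thesis by (simp add: overlap_sum_def)
  next
    case 2
    have "0 \<le> a (int i + m) - a (int i) + t" for i
      using gap_less[of "int i" "int i + m"] 2 assms by linarith
    then show ?thesis by (intro *[of 1]) auto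
  next
    case 3
    have "a (int i + m) - a (int i) + t \<le> 0" for i
      using gap_less[of "int i + m" "int i"] 3 assms by linarith
    then show ?thesis by (intro *[of "-1"]) auto
  qed
qed

text \<open>The bounds on \<open>h - t\<close> make the term for \<open>i\<close> positive and the
  one for \<open>j\<close> negative before positive parts are taken: the strict case of
  Jensen.\<close>

lemma overlap_sum_gt:
  assumes "\<bar>t\<bar> \<le> \<delta>" "i < L" "j < L"
    and "a (int i + 1) - a (int i) < h - t" "h - t < a (int j + 1) - a (int j)"
  shows "real L * overlap h (spacing + t) < overlap_sum h 1 t"
proof -
  have nonneg: "0 \<le> a (int i + 1) - a (int i) + t" for i
    using gap[of "int i"] assms by linarith
  have pos: "0 \<le> spacing + t"
    using assms(1) mult_pos_pos[OF Lambda_pos delta_pos] by (simp add: distrib_right)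
  have s: "(\<Sum>i<L. a (int i + 1) - a (int i) + t) = real L * (spacing + t)"
    unfolding sum.distrib using sum_gaps[of 1] by (simp add: distrib_left)
  have "real L * overlap h (spacing + t) = max 0 (\<Sum>i<L. h - (a (int i + 1) - a (int i) + t))"
    unfolding sum_subtractf[of "\<lambda>_. h"] s using pos
    by (simp add: overlap_def max_mult_distrib_left right_diff_distrib)
  also have "\<dots> < (\<Sum>i<L. max 0 (h - (a (int i + 1) - a (int i) + t)))"
    using assms by (intro max_0_sum_less[of _ i j]) auto
  also have "\<dots> = overlap_sum h 1 t" by (simp add: overlap_sum_def overlap_def nonneg)
  finally show ?thesis .
qed

text \<open>The gaps of one period average to \<open>spacing\<close>, so a deviating gap forces one
  below and one above.\<close>

lemma unequal_gaps:
  assumes "\<not> (\<forall>k. a (k + 1) - a k = spacing)"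
  obtains i j where "i < L" "j < L" "a (int i + 1) - a (int i) < spacing" "spacing < a (int j + 1) - a (int j)"
proof -
  have s: "(\<Sum>i<L. a (int i + 1) - a (int i)) = (\<Sum>i<L. spacing)"
    using sum_gaps[of 1] by simp
  have "\<exists>i<L. a (int i + 1) - a (int i) \<noteq> spacing"
  proof (rule ccontr)
    assume "\<not> ?thesis"
    then have eq: "a (int i + 1) - a (int i) = spacing" if "i < L" for i using that by blast
    have "a (k + 1) - a k = spacing" for k
    proof -
      \<comment> \<open>The gaps are periodic in the index, so equality for the first
        \<open>L\<close> of them extends to all integers.\<close>
      interpret g: periodic_fun_simple "\<lambda>x. a (x + 1) - a x" "int L"
      proof
        fix x
        show "a (x + int L + 1) - a (x + int L) = a (x + 1) - a x"
          using per[of "x + 1"] per[of x] by (simp add: ac_simps)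
      qed
      have "k mod int L + k div int L * int L = k" by simp
      then have "a (k + 1) - a k = a (k mod int L + 1) - a (k mod int L)"
        using g.plus_of_int[of "k mod int L" "k div int L"] by simp
      also have "\<dots> = spacing"
        using eq[of "nat (k mod int L)"] L_pos by (simp add: nat_less_iff)
      finally show ?thesis .
    qed
    with assms show False by blast
  qed
  then obtain i where i: "i < L" "a (int i + 1) - a (int i) \<noteq> spacing" by blast
  have "\<exists>i<L. a (int i + 1) - a (int i) < spacing"
  proof (rule ccontr)
    assume "\<not> ?thesis"
    then have ge: "spacing \<le> a (int i + 1) - a (int i)" if "i < L" for i using that by (meson not_less)
    have "(\<Sum>i<L. spacing) < (\<Sum>i<L. a (int i + 1) - a (int i))"
      using i ge[of i] by (intro sum_strict_mono_ex1 bexI[of _ i] ballI ge) auto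
    with s show False by simp
  qed
  moreover have "\<exists>i<L. spacing < a (int i + 1) - a (int i)"
  proof (rule ccontr)
    assume "\<not> ?thesis"
    then have le: "a (int i + 1) - a (int i) \<le> spacing" if "i < L" for i using that by (meson not_less)
    have "(\<Sum>i<L. a (int i + 1) - a (int i)) < (\<Sum>i<L. spacing)"
      using i le[of i] by (intro sum_strict_mono_ex1 bexI[of _ i] ballI le) auto
    with s show False by simp
  qed
  ultimately show ?thesis using that by blast
qed

text \<open>The right side of \<open>window_energy_eq\<close> with all gaps equal. As the formula
  does not mention \<open>a\<close>, two sequences with the same parameters can be compared through
  it.\<close>

definition equispaced_energy :: "real \<Rightarrow> ennreal" where
  "equispaced_energy h =
    (\<integral>\<^sup>+(m::int). (\<integral>\<^sup>+v\<in>{0..<\<delta>}. (\<integral>\<^sup>+w\<in>{0..<\<delta>}. ennreal (real L * overlap h (of_int m * spacing + (w - v))) \<partial>lborel) \<partial>lborel) \<partial>count_space UNIV)"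

lemma window_energy_equispaced:
  assumes "\<And>k. a (k + 1) - a k = spacing" and "h > 0"
  shows "window_energy h = equispaced_energy h"
proof -
  have "a (k + m) = a k + of_int m * spacing" for k m
  proof (induction m rule: int_induct[where k = 0])
    case base
    show ?case by simp
  next
    case (step1 m)
    then show ?case using assms(1)[of "k + m"] by (simp add: algebra_simps)
  next
    case (step2 m)
    then show ?case using assms(1)[of "k + m - 1"] by (simp add: algebra_simps)
  qed
  then have "overlap_sum h m t = real L * overlap h (of_int m * spacing + t)" for m t
    unfolding overlap_sum_def by simp
  then show ?thesis unfolding window_energy_eq[OF \<open>h > 0\<close>] equispaced_energy_def by simp
qed

lemma inner_mono:
  "(\<integral>\<^sup>+v\<in>{0..<\<delta>}. (\<integral>\<^sup>+w\<in>{0..<\<delta>}. ennreal (real L * overlap h (of_int m * spacing + (w - v))) \<partial>lborel) \<partial>lborel)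
    \<le> (\<integral>\<^sup>+v\<in>{0..<\<delta>}. (\<integral>\<^sup>+w\<in>{0..<\<delta>}. ennreal (overlap_sum h m (w - v)) \<partial>lborel) \<partial>lborel)"
  unfolding nn_integral_multc[symmetric]
  by (intro nn_integral_mono) (auto split: split_indicator intro!: nn_integral_mono ennreal_leI overlap_sum_ge)

lemma equispaced_energy_le:
  assumes "h > 0"
  shows "equispaced_energy h \<le> window_energy h"
  unfolding window_energy_eq[OF assms] equispaced_energy_def
  by (intro nn_integral_mono inner_mono)

text \<open>Strictness at \<open>m = 1\<close> suffices. Since \<open>h\<close> lies strictly
  between two gaps, so does \<open>h - (w - v)\<close> for all \<open>w\<close> close to
  \<open>v\<close>.\<close>

lemma equispaced_energy_less:
  assumes "h > 0" and fin: "equispaced_energy h < \<infinity>"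
    and ij: "i < L" "j < L" "a (int i + 1) - a (int i) < h" "h < a (int j + 1) - a (int j)"
  shows "equispaced_energy h < window_energy h"
proof -
  let ?f = "\<lambda>m v. (\<integral>\<^sup>+w\<in>{0..<\<delta>}. ennreal (real L * overlap h (of_int m * spacing + (w - v))) \<partial>lborel)"
  let ?g = "\<lambda>m v. (\<integral>\<^sup>+w\<in>{0..<\<delta>}. ennreal (overlap_sum h m (w - v)) \<partial>lborel)"
  \<comment> \<open>This bound supplies the finiteness without which a strict comparison of
    integrals fails.\<close>
  have f_le: "?f m v \<le> ennreal (real L * h) * ennreal \<delta>" for m v
  proof -
    have "?f m v \<le> (\<integral>\<^sup>+w\<in>{0..<\<delta>}. ennreal (real L * h) \<partial>lborel)"
      using \<open>h > 0\<close>
      by (intro nn_integral_mono) (auto split: split_indicator intro!: ennreal_leI mult_left_mono simp: overlap_def)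
    also have "\<dots> = ennreal (real L * h) * ennreal \<delta>"
      using delta_pos by (simp add: nn_integral_cmult_indicator)
    finally show ?thesis .
  qed
  have strict: "?f 1 v < ?g 1 v" if v: "0 < v" "v < \<delta>" for v
  proof (rule nn_integral_less)
    show "(\<integral>\<^sup>+w\<in>{0..<\<delta>}. ennreal (real L * overlap h (of_int 1 * spacing + (w - v))) \<partial>lborel) \<noteq> \<infinity>"
      using f_le[of 1 v] by (auto simp: ennreal_mult_eq_top_iff top_unique)
    show "AE w in lborel. ennreal (real L * overlap h (of_int 1 * spacing + (w - v))) * indicator {0..<\<delta>} w
       \<le> ennreal (overlap_sum h 1 (w - v)) * indicator {0..<\<delta>} w"
      using v by (intro AE_I2) (auto split: split_indicator intro!: ennreal_leI overlap_sum_ge[of _ _ 1, simplified])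
    show "\<not> (AE w in lborel. ennreal (overlap_sum h 1 (w - v)) * indicator {0..<\<delta>} w
       \<le> ennreal (real L * overlap h (of_int 1 * spacing + (w - v))) * indicator {0..<\<delta>} w)" (is "\<not> (AE w in lborel. ?le w)")
    proof
      assume "AE w in lborel. ?le w"
      \<comment> \<open>The bounds keep \<open>w\<close> strictly between \<open>0\<close> and
        \<delta>, and \<open>h - (w - v)\<close> strictly between the two gaps.\<close>
      then obtain w where w: "max 0 (v - (a (int j + 1) - a (int j) - h)) < w" "w < min \<delta> (v + (h - (a (int i + 1) - a (int i))))" "?le w"
        by (rule AE_lborel_in_Ioo[where a = "max 0 (v - (a (int j + 1) - a (int j) - h))"
              and b = "min \<delta> (v + (h - (a (int i + 1) - a (int i))))"]) (use ij v delta_pos in auto)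
      have "real L * overlap h (spacing + (w - v)) < overlap_sum h 1 (w - v)"
        using w v ij by (intro overlap_sum_gt[of _ i j]) auto
      moreover have "ennreal (overlap_sum h 1 (w - v)) \<le> ennreal (real L * overlap h (spacing + (w - v)))"
        using w by simp
      then have "overlap_sum h 1 (w - v) \<le> real L * overlap h (spacing + (w - v))"
        by (subst (asm) ennreal_le_iff) (simp_all add: overlap_nonneg)
      ultimately show False by simp
    qed
  qed measurable
  have "(\<integral>\<^sup>+v\<in>{0..<\<delta>}. ?f 1 v \<partial>lborel) < (\<integral>\<^sup>+v\<in>{0..<\<delta>}. ?g 1 v \<partial>lborel)"
  proof (rule nn_integral_less)
    have "(\<integral>\<^sup>+v\<in>{0..<\<delta>}. ?f 1 v \<partial>lborel) \<le> (\<integral>\<^sup>+v\<in>{0..<\<delta>}. ennreal (real L * h) * ennreal \<delta> \<partial>lborel)"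
      by (intro nn_integral_mono mult_right_mono f_le) simp
    also have "\<dots> < \<infinity>"
      using delta_pos by (simp add: nn_integral_cmult_indicator ennreal_mult_less_top)
    finally show "(\<integral>\<^sup>+v\<in>{0..<\<delta>}. ?f 1 v \<partial>lborel) \<noteq> \<infinity>" by simp
    have le: "?f 1 v * indicator {0..<\<delta>} v \<le> ?g 1 v * indicator {0..<\<delta>} v" for v
      by (auto split: split_indicator intro!: nn_integral_mono ennreal_leI overlap_sum_ge[of _ _ 1, simplified])
    then show "AE v in lborel. ?f 1 v * indicator {0..<\<delta>} v \<le> ?g 1 v * indicator {0..<\<delta>} v"
      by (rule AE_I2)
    show "\<not> (AE v in lborel. ?g 1 v * indicator {0..<\<delta>} v \<le> ?f 1 v * indicator {0..<\<delta>} v)"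
    proof
      assume "AE v in lborel. ?g 1 v * indicator {0..<\<delta>} v \<le> ?f 1 v * indicator {0..<\<delta>} v"
      then obtain v where "0 < v" "v < \<delta>" "?g 1 v * indicator {0..<\<delta>} v \<le> ?f 1 v * indicator {0..<\<delta>} v"
        by (rule AE_lborel_in_Ioo[OF _ delta_pos])
      with strict[of v] show False by (simp add: leD)
    qed
  qed measurable
  then show ?thesis
    using fin unfolding window_energy_eq[OF \<open>h > 0\<close>] equispaced_energy_def
    by (intro nn_integral_less) (auto simp: AE_count_space not_le intro!: inner_mono exI[of _ 1])
qed

end

section \<open>Energy of sawtooth functions\<close>

lemma nn_integral_even_le:
  fixes f :: "real \<Rightarrow> ennreal"
  assumes [measurable]: "f \<in> borel_measurable borel"
  shows "(\<integral>\<^sup>+x. f \<bar>x\<bar> \<partial>lborel) \<le> 2 * (\<integral>\<^sup>+x\<in>{0..}. f x \<partial>lborel)"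
proof -
  have "(\<integral>\<^sup>+x. f \<bar>x\<bar> \<partial>lborel) \<le> (\<integral>\<^sup>+x. f x * indicator {0..} x + f (- x) * indicator {0..} (- x) \<partial>lborel)"
    by (intro nn_integral_mono) (auto split: split_indicator)
  also have "\<dots> = (\<integral>\<^sup>+x\<in>{0..}. f x \<partial>lborel) + (\<integral>\<^sup>+x. f (- x) * indicator {0..} (- x) \<partial>lborel)"
    by (rule nn_integral_add) measurable
  also have "(\<integral>\<^sup>+x. f (- x) * indicator {0..} (- x) \<partial>lborel) = (\<integral>\<^sup>+x\<in>{0..}. f x \<partial>lborel)"
    using nn_integral_real_affine[of "\<lambda>x. f x * indicator {0..} x" "-1" 0] by simp
  finally show ?thesis by (simp add: mult_2)
qed

text \<open>Below \<open>c\<close> the factor \<open>h\<^sup>2\<close> leaves the exponent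
  \<open>1 - 2 * s\<close>, integrable at 0 as \<open>s < 1\<close>. Above \<open>c\<close> the
  numerator is constant and the exponent \<open>- 1 - 2 * s\<close> is integrable at infinity as
  \<open>s > 0\<close>.\<close>

lemma kernel_integral_finite:
  assumes "0 < s" "s < 1" "c > 0"
  shows "(\<integral>\<^sup>+h. ennreal (1 / \<bar>h\<bar> powr (1 + 2 * s) * min (h\<^sup>2) (c\<^sup>2)) \<partial>lborel) < \<infinity>"
proof -
  let ?f = "\<lambda>h. ennreal (1 / h powr (1 + 2 * s) * min (h\<^sup>2) (c\<^sup>2))"
  have "(\<integral>\<^sup>+h. ennreal (1 / \<bar>h\<bar> powr (1 + 2 * s) * min (h\<^sup>2) (c\<^sup>2)) \<partial>lborel) \<le> 2 * (\<integral>\<^sup>+h\<in>{0..}. ?f h \<partial>lborel)"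
    using nn_integral_even_le[of ?f] by simp
  also have "\<dots> < \<infinity>"
  proof -
    have "(\<integral>\<^sup>+h\<in>{0..}. ?f h \<partial>lborel) \<le>
      (\<integral>\<^sup>+h. ennreal (h powr (1 - 2 * s)) * indicator {0..c} h + ennreal (c\<^sup>2) * (ennreal (h powr (- 1 - 2 * s)) * indicator {c..} h) \<partial>lborel)"
    proof (rule nn_integral_mono)
      fix h
      have 1: "1 / h powr (1 + 2 * s) * min (h\<^sup>2) (c\<^sup>2) \<le> h powr (1 - 2 * s)" if "h \<ge> 0"
      proof (cases "h = 0")
        case False
        have "h powr (1 - 2 * s) = 1 / h powr (1 + 2 * s) * h powr 2"
          by (simp add: powr_minus_divide[symmetric] powr_add[symmetric])
        then show ?thesis using that False by (simp add: divide_right_mono)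
      qed simp
      have 2: "1 / h powr (1 + 2 * s) * min (h\<^sup>2) (c\<^sup>2) \<le> c\<^sup>2 * h powr (- 1 - 2 * s)"
      proof -
        have "h powr (- 1 - 2 * s) = 1 / h powr (1 + 2 * s)"
          using powr_minus_divide[of h "1 + 2 * s"] by simp
        then show ?thesis by (simp add: divide_right_mono)
      qed
      show "?f h * indicator {0..} h \<le>
        ennreal (h powr (1 - 2 * s)) * indicator {0..c} h + ennreal (c\<^sup>2) * (ennreal (h powr (- 1 - 2 * s)) * indicator {c..} h)"
      proof (cases "0 \<le> h \<and> h \<le> c")
        case True
        then have "?f h * indicator {0..} h \<le> ennreal (h powr (1 - 2 * s)) * indicator {0..c} h"
          using 1 by (simp add: ennreal_leI)
        then show ?thesis by (rule order_trans) simp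
      next
        case False
        then show ?thesis using 2 \<open>c > 0\<close>
          by (auto split: split_indicator simp: ennreal_mult[symmetric] intro!: ennreal_leI)
      qed
    qed
    also have "\<dots> = (\<integral>\<^sup>+h\<in>{0..c}. ennreal (h powr (1 - 2 * s)) \<partial>lborel) + ennreal (c\<^sup>2) * (\<integral>\<^sup>+h\<in>{c..}. ennreal (h powr (- 1 - 2 * s)) \<partial>lborel)"
      by (subst nn_integral_add) (auto simp: nn_integral_cmult)
    also have "\<dots> < \<infinity>"
      using nn_integral_has_integral_lebesgue'[OF _ has_integral_powr_from_0[of "1 - 2 * s" c]]
        nn_integral_has_integral_lebesgue'[OF _ has_integral_powr_to_inf[of "- 1 - 2 * s" c]] assms
      by (simp add: ennreal_mult_less_top)
    finally show ?thesis by (simp add: ennreal_mult_less_top)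
  qed
  finally show ?thesis .
qed

text \<open>\<open>increment\<close> is the integrated form of having slope -\<Lambda> on the drops
  and 1 elsewhere. It determines \<open>u\<close> from \<open>a\<close> up to a constant and keeps
  derivatives out of the energy estimates.\<close>

locale sawtooth = drop_sequence +
  fixes u :: "real \<Rightarrow> real"
  assumes increment: "x \<le> y \<Longrightarrow> u y - u x = (y - x) - (1 + \<Lambda>) * measure lborel (drops \<inter> {x..y})"
    and u_periodic: "u (x + T) = u x"
begin

lemma increment_window: "0 \<le> h \<Longrightarrow> u (x + h) - u x = h - (1 + \<Lambda>) * window h x"
  using increment[of x "x + h"] by (simp add: window_def)

lemma window_bounds: "0 \<le> h \<Longrightarrow> 0 \<le> window h x \<and> window h x \<le> h"
proof -
  assume "0 \<le> h"
  have "emeasure lborel (drops \<inter> {x..x + h}) \<le> emeasure lborel {x..x + h}"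
    by (intro emeasure_mono) auto
  then show ?thesis using \<open>0 \<le> h\<close> by (simp add: emeasure_window) (simp add: window_def)
qed

lemma u_lipschitz: "\<bar>u y - u x\<bar> \<le> (1 + \<Lambda>) * \<bar>y - x\<bar>"
proof -
  have *: "\<bar>u (x + h) - u x\<bar> \<le> (1 + \<Lambda>) * h" if "h \<ge> 0" for x h
  proof -
    have "(1 + \<Lambda>) * window h x \<le> (1 + \<Lambda>) * h" "0 \<le> (1 + \<Lambda>) * window h x" "0 \<le> \<Lambda> * h"
      using window_bounds[OF that, of x] Lambda_pos that by auto
    then show ?thesis unfolding increment_window[OF that] using that by (simp add: distrib_right abs_le_iff)
  qed
  show ?thesis
  proof (cases "x \<le> y")
    case True
    then show ?thesis using *[of "y - x" x] by simp
  next
    case False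
    then show ?thesis using *[of "x - y" y] by (simp add: abs_minus_commute)
  qed
qed

lemma u_continuous: "continuous_on A u"
proof -
  have "(1 + \<Lambda>)-lipschitz_on A u"
    using u_lipschitz Lambda_pos by (intro lipschitz_onI) (auto simp: dist_real_def)
  then show ?thesis by (rule lipschitz_on_continuous_on)
qed

lemma u_measurable [measurable]: "u \<in> borel_measurable borel"
  by (intro borel_measurable_continuous_onI u_continuous)

text \<open>Shifting \<open>y\<close> by whole periods brings it within distance \<open>T\<close> of
  \<open>x\<close>, where the Lipschitz bound applies.\<close>

lemma u_oscillation: "\<bar>u y - u x\<bar> \<le> (1 + \<Lambda>) * T"
proof -
  interpret periodic_fun_simple u T by standard (rule u_periodic)
  define n where "n = \<lfloor>(y - x) / T\<rfloor>"
  have "of_int n \<le> (y - x) / T" "(y - x) / T < of_int n + 1" by (auto simp: n_def)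
  then have "0 \<le> y - of_int n * T - x" "y - of_int n * T - x \<le> T"
    using T_pos by (auto simp: field_simps)
  moreover have "u (y - of_int n * T) = u y" by (rule minus_of_int)
  ultimately show ?thesis
    using u_lipschitz[of "y - of_int n * T" x] Lambda_pos
    by (smt (verit) mult_left_mono)
qed

text \<open>The Lipschitz bound controls small \<open>h\<close>, the oscillation bound large
  \<open>h\<close>; against the kernel the result is integrable at both ends.\<close>

lemma increment_energy_le:
  "increment_energy T u h \<le> ennreal (T * (1 + \<Lambda>)\<^sup>2 * min (h\<^sup>2) (T\<^sup>2))"
proof -
  have "(u (x + h) - u x)\<^sup>2 \<le> (1 + \<Lambda>)\<^sup>2 * min (h\<^sup>2) (T\<^sup>2)" for x
  proof -
    have "(u (x + h) - u x)\<^sup>2 \<le> ((1 + \<Lambda>) * \<bar>h\<bar>)\<^sup>2" "(u (x + h) - u x)\<^sup>2 \<le> ((1 + \<Lambda>) * T)\<^sup>2"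
      using u_lipschitz[of "x + h" x] u_oscillation[of "x + h" x] Lambda_pos T_pos by (auto simp: abs_le_square_iff[symmetric] abs_mult intro: order_trans)
    then show ?thesis by (simp add: power_mult_distrib min_def)
  qed
  then have "increment_energy T u h \<le> (\<integral>\<^sup>+x\<in>{0..<T}. ennreal ((1 + \<Lambda>)\<^sup>2 * min (h\<^sup>2) (T\<^sup>2)) \<partial>lborel)"
    unfolding increment_energy_def by (intro nn_integral_mono mult_right_mono ennreal_leI) auto
  also have "\<dots> = ennreal (T * (1 + \<Lambda>)\<^sup>2 * min (h\<^sup>2) (T\<^sup>2))"
    using T_pos by (subst nn_integral_cmult_indicator) (auto simp: ennreal_mult[symmetric] ac_simps)
  finally show ?thesis .
qed

lemma F_s_finite:
  assumes "0 < s" "s < 1"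
  shows "F_s T s u < \<infinity>"
proof -
  have "(\<integral>\<^sup>+h. ennreal (1 / \<bar>h\<bar> powr (1 + 2 * s)) * increment_energy T u h \<partial>lborel) \<le>
    (\<integral>\<^sup>+h. ennreal (T * (1 + \<Lambda>)\<^sup>2) * ennreal (1 / \<bar>h\<bar> powr (1 + 2 * s) * min (h\<^sup>2) (T\<^sup>2)) \<partial>lborel)"
  proof (rule nn_integral_mono)
    fix h
    have "ennreal (1 / \<bar>h\<bar> powr (1 + 2 * s)) * increment_energy T u h \<le>
       ennreal (1 / \<bar>h\<bar> powr (1 + 2 * s)) * ennreal (T * (1 + \<Lambda>)\<^sup>2 * min (h\<^sup>2) (T\<^sup>2))"
      by (intro mult_left_mono increment_energy_le) simp
    also have "\<dots> = ennreal (T * (1 + \<Lambda>)\<^sup>2) * ennreal (1 / \<bar>h\<bar> powr (1 + 2 * s) * min (h\<^sup>2) (T\<^sup>2))"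
      using T_pos by (simp add: ennreal_mult[symmetric] ac_simps)
    finally show "ennreal (1 / \<bar>h\<bar> powr (1 + 2 * s)) * increment_energy T u h \<le>
      ennreal (T * (1 + \<Lambda>)\<^sup>2) * ennreal (1 / \<bar>h\<bar> powr (1 + 2 * s) * min (h\<^sup>2) (T\<^sup>2))" .
  qed
  also have "\<dots> = ennreal (T * (1 + \<Lambda>)\<^sup>2) * (\<integral>\<^sup>+h. ennreal (1 / \<bar>h\<bar> powr (1 + 2 * s) * min (h\<^sup>2) (T\<^sup>2)) \<partial>lborel)"
    by (rule nn_integral_cmult) measurable
  also have "\<dots> < \<infinity>"
    using kernel_integral_finite[OF assms T_pos] by (simp add: ennreal_mult_less_top)
  finally show ?thesis
    unfolding F_s_eq_increment_energy[OF u_measurable] by (simp add: ennreal_mult_less_top)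
qed

text \<open>Squaring \<open>(1 + \<Lambda>) window = h - (u (x + h) - u x)\<close>, the mixed term integrates to zero over a
  period. Adding \<open>M\<close> keeps all integrands nonnegative.\<close>

lemma increment_energy_window:
  assumes h: "h > 0"
  shows "increment_energy T u h + ennreal (h\<^sup>2 * T) = ennreal ((1 + \<Lambda>)\<^sup>2) * window_energy h"
proof -
  \<comment> \<open>The constant is read off from the oscillation bound between \<open>0\<close> and
    \<open>x\<close>.\<close>
  define M where "M = (1 + \<Lambda>) * T - u 0"
  have M: "0 \<le> u x + M" for x
    using u_oscillation[of 0 x] unfolding M_def by linarith
  let ?E = "\<integral>\<^sup>+x\<in>{0..<T}. ennreal (2 * h * (u x + M)) \<partial>lborel"
  have E: "(\<integral>\<^sup>+x\<in>{0..<T}. ennreal (2 * h * (u (x + h) + M)) \<partial>lborel) = ?E"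
    using T_pos u_periodic
    by (intro nn_integral_periodic_translate[where f="\<lambda>x. ennreal (2 * h * (u x + M))"]) auto
  have E_fin: "?E \<noteq> \<infinity>"
  proof -
    have "u x + M \<le> 2 * ((1 + \<Lambda>) * T)" for x
      using u_oscillation[of x 0] unfolding M_def by linarith
    then have "?E \<le> (\<integral>\<^sup>+x\<in>{0..<T}. ennreal (2 * h * (2 * ((1 + \<Lambda>) * T))) \<partial>lborel)"
      using h by (intro nn_integral_mono mult_right_mono ennreal_leI mult_left_mono) auto
    also have "\<dots> < \<infinity>"
      using T_pos by (simp add: nn_integral_cmult_indicator ennreal_mult_less_top)
    finally show ?thesis by simp
  qed
  \<comment> \<open>Solved for the window, the increment formula exhibits it as a continuous
    function of \<open>x\<close>.\<close>
  have [measurable]: "window h \<in> borel_measurable borel"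
  proof -
    have "window h = (\<lambda>x. (h - (u (x + h) - u x)) / (1 + \<Lambda>))"
      using increment_window[of h] h Lambda_pos by (auto simp: fun_eq_iff field_simps)
    then show ?thesis by simp
  qed
  have "(increment_energy T u h + ennreal (h\<^sup>2 * T)) + ?E =
    (\<integral>\<^sup>+x. ennreal ((u (x + h) - u x)\<^sup>2) * indicator {0..<T} x + ennreal (h\<^sup>2) * indicator {0..<T} x
      + ennreal (2 * h * (u x + M)) * indicator {0..<T} x \<partial>lborel)"
    unfolding increment_energy_def using T_pos
    by (simp add: nn_integral_add nn_integral_cmult_indicator ennreal_mult)
  also have "\<dots> = (\<integral>\<^sup>+x. ennreal ((1 + \<Lambda>)\<^sup>2) * (ennreal ((window h x)\<^sup>2) * indicator {0..<T} x)
      + ennreal (2 * h * (u (x + h) + M)) * indicator {0..<T} x \<partial>lborel)"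
  proof (rule nn_integral_cong)
    fix x
    have "(1 + \<Lambda>) * window h x = h - (u (x + h) - u x)"
      using increment_window[of h x] h by simp
    then have "(1 + \<Lambda>)\<^sup>2 * (window h x)\<^sup>2 = (h - (u (x + h) - u x))\<^sup>2"
      by (simp flip: power_mult_distrib)
    \<comment> \<open>The mixed term is split between the two sides, where its halves integrate to
      the same finite \<open>?E\<close> and cancel.\<close>
    then have "(u (x + h) - u x)\<^sup>2 + h\<^sup>2 + 2 * h * (u x + M) = (1 + \<Lambda>)\<^sup>2 * (window h x)\<^sup>2 + 2 * h * (u (x + h) + M)"
      by (simp add: power2_eq_square algebra_simps)
    then have "ennreal ((u (x + h) - u x)\<^sup>2) + ennreal (h\<^sup>2) + ennreal (2 * h * (u x + M)) =
      ennreal ((1 + \<Lambda>)\<^sup>2) * ennreal ((window h x)\<^sup>2) + ennreal (2 * h * (u (x + h) + M))"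
      using M h by (simp add: ennreal_plus[symmetric] ennreal_mult[symmetric] del: ennreal_plus)
    then show "ennreal ((u (x + h) - u x)\<^sup>2) * indicator {0..<T} x + ennreal (h\<^sup>2) * indicator {0..<T} x
      + ennreal (2 * h * (u x + M)) * indicator {0..<T} x =
      ennreal ((1 + \<Lambda>)\<^sup>2) * (ennreal ((window h x)\<^sup>2) * indicator {0..<T} x)
      + ennreal (2 * h * (u (x + h) + M)) * indicator {0..<T} x"
      by (auto split: split_indicator)
  qed
  also have "\<dots> = ennreal ((1 + \<Lambda>)\<^sup>2) * window_energy h + ?E"
    unfolding window_energy_def E[symmetric]
    by (subst nn_integral_add) (auto simp: nn_integral_cmult)
  finally show ?thesis using E_fin by (simp add: add.commute[of _ ?E] ennreal_add_left_cancel)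
qed

end

text \<open>The comparison is made for each \<open>h\<close>: by
  \<open>increment_energy_window\<close> both increment energies depend on the window energies
  through the same constants. Unequal gaps give strictness for all \<open>h\<close> between a
  smaller and a larger gap.\<close>

lemma
  assumes "sawtooth \<Lambda> \<delta> T L a u" "sawtooth \<Lambda> \<delta> T L b v"
    and b: "\<And>k. b (k + 1) - b k = (\<Lambda> + 1) * \<delta>" and s: "0 < s" "s < 1"
  shows F_s_equispaced_le: "F_s T s v \<le> F_s T s u"
    and F_s_equispaced_less: "\<not> (\<forall>k. a (k + 1) - a k = (\<Lambda> + 1) * \<delta>) \<Longrightarrow> F_s T s v < F_s T s u"
proof -
  interpret A: sawtooth \<Lambda> \<delta> T L a u by fact
  interpret B: sawtooth \<Lambda> \<delta> T L b v by fact
  let ?K = "\<lambda>h. ennreal (1 / \<bar>h\<bar> powr (1 + 2 * s))"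
  have c_pos: "0 < ennreal ((1 + \<Lambda>)\<^sup>2)" using A.Lambda_pos by simp
  have B_eq: "increment_energy T v h + ennreal (h\<^sup>2 * T) = ennreal ((1 + \<Lambda>)\<^sup>2) * A.equispaced_energy h" if "h > 0" for h
    using B.increment_energy_window[OF that] B.window_energy_equispaced[OF b that] by simp
  have le_pos: "increment_energy T v h \<le> increment_energy T u h" if "h > 0" for h
  proof -
    have "increment_energy T v h + ennreal (h\<^sup>2 * T) \<le> increment_energy T u h + ennreal (h\<^sup>2 * T)"
      unfolding B_eq[OF that] A.increment_energy_window[OF that]
      by (intro mult_left_mono A.equispaced_energy_le that) simp
    then show ?thesis by (simp add: add.commute[of _ "ennreal (h\<^sup>2 * T)"] ennreal_add_left_cancel_le)
  qed
  have le: "increment_energy T v h \<le> increment_energy T u h" for h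
  proof (cases h "0::real" rule: linorder_cases)
    case less
    then show ?thesis
      using le_pos[of "- h"] A.u_periodic B.u_periodic A.T_pos
        increment_energy_uminus[OF A.u_measurable, of T h] increment_energy_uminus[OF B.u_measurable, of T h] by simp
  next
    case equal
    then show ?thesis by (simp add: increment_energy_def)
  next
    case greater
    then show ?thesis by (rule le_pos)
  qed
  have const: "0 < ennreal (1 / (2 * T))" "ennreal (1 / (2 * T)) < \<infinity>" using A.T_pos by auto
  show "F_s T s v \<le> F_s T s u"
    unfolding F_s_eq_increment_energy[OF A.u_measurable] F_s_eq_increment_energy[OF B.u_measurable]
    by (intro mult_left_mono nn_integral_mono le) auto
  assume "\<not> (\<forall>k. a (k + 1) - a k = (\<Lambda> + 1) * \<delta>)"
  then obtain i j where ij: "i < L" "j < L" "a (int i + 1) - a (int i) < (\<Lambda> + 1) * \<delta>"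
      "(\<Lambda> + 1) * \<delta> < a (int j + 1) - a (int j)"
    by (rule A.unequal_gaps)
  have less: "increment_energy T v h < increment_energy T u h"
    if h: "a (int i + 1) - a (int i) < h" "h < a (int j + 1) - a (int j)" for h
  proof -
    have h0: "h > 0" using h A.gap[of "int i"] A.delta_pos by linarith
    \<comment> \<open>Finiteness of the equispaced energy is inherited from the increment bound for
      \<open>v\<close>.\<close>
    have "increment_energy T v h + ennreal (h\<^sup>2 * T) < \<infinity>"
      using B.increment_energy_le[of h] by (auto simp: less_top[symmetric] top_unique)
    then have "A.equispaced_energy h < \<infinity>"
      unfolding B_eq[OF h0] using A.Lambda_pos by (auto simp: ennreal_mult_less_top less_top[symmetric])
    then have "A.equispaced_energy h < A.window_energy h"
      by (rule A.equispaced_energy_less[OF h0 _ ij(1,2) h])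
    then have "increment_energy T v h + ennreal (h\<^sup>2 * T) < increment_energy T u h + ennreal (h\<^sup>2 * T)"
      unfolding B_eq[OF h0] A.increment_energy_window[OF h0]
      using c_pos by (intro ennreal_mult_strict_left_mono) auto
    then show ?thesis by (simp add: add.commute[of _ "ennreal (h\<^sup>2 * T)"] ennreal_add_left_cancel_less)
  qed
  have "(\<integral>\<^sup>+h. ?K h * increment_energy T v h \<partial>lborel) < (\<integral>\<^sup>+h. ?K h * increment_energy T u h \<partial>lborel)"
  proof (rule nn_integral_less)
    show "(\<integral>\<^sup>+h. ?K h * increment_energy T v h \<partial>lborel) \<noteq> \<infinity>"
      using B.F_s_finite[OF s] const unfolding F_s_eq_increment_energy[OF B.u_measurable]
      by (auto simp: ennreal_mult_less_top)
    show "AE h in lborel. ?K h * increment_energy T v h \<le> ?K h * increment_energy T u h"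
      by (intro AE_I2 mult_left_mono le) simp
    show "\<not> (AE h in lborel. ?K h * increment_energy T u h \<le> ?K h * increment_energy T v h)"
    proof
      assume "AE h in lborel. ?K h * increment_energy T u h \<le> ?K h * increment_energy T v h"
      then obtain h where h: "a (int i + 1) - a (int i) < h" "h < a (int j + 1) - a (int j)"
          "?K h * increment_energy T u h \<le> ?K h * increment_energy T v h"
        by (rule AE_lborel_in_Ioo[where a = "a (int i + 1) - a (int i)" and b = "a (int j + 1) - a (int j)"])
           (use ij in auto)
      have "h > 0" using h A.gap[of "int i"] A.delta_pos by linarith
      then have "?K h * increment_energy T v h < ?K h * increment_energy T u h"
        by (intro ennreal_mult_strict_left_mono less h) auto
      with h show False by simp
    qed
  qed measurable
  then show "F_s T s v < F_s T s u"
    unfolding F_s_eq_increment_energy[OF A.u_measurable] F_s_eq_increment_energy[OF B.u_measurable]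
    using const by (intro ennreal_mult_strict_left_mono) auto
qed

section \<open>Structure of admissible functions\<close>

text \<open>The fundamental theorem of calculus tolerates the finitely many points of
  \<open>S\<close> in \<open>{x..y}\<close>. Passing from \<open>D\<close> to the measurable set
  \<open>A\<close> changes the integrand only on a null set.\<close>

lemma increment_eq_measure:
  fixes u :: "real \<Rightarrow> real"
  assumes u: "continuous_on UNIV u" and S: "finite (S \<inter> {x..y})" and A [measurable]: "A \<in> sets borel"
    and der: "\<And>t. t \<notin> S \<Longrightarrow> (u has_real_derivative (if t \<in> D then - \<Lambda> else 1)) (at t)"
    and D: "AE t in lborel. t \<in> D \<longleftrightarrow> t \<in> A" and "x \<le> y"
  shows "u y - u x = (y - x) - (1 + \<Lambda>) * measure lborel (A \<inter> {x..y})"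
proof -
  have "((\<lambda>t. if t \<in> D then - \<Lambda> else 1) has_integral u y - u x) {x..y}"
  proof (rule fundamental_theorem_of_calculus_interior_strong[OF S \<open>x \<le> y\<close>])
    show "(u has_vector_derivative (if t \<in> D then - \<Lambda> else 1)) (at t)" if "t \<in> {x<..<y} - S \<inter> {x..y}" for t
      using der[of t] that by (auto simp: has_real_derivative_iff_has_vector_derivative)
    show "continuous_on {x..y} u" using u by (rule continuous_on_subset) simp
  qed
  then have 1: "((\<lambda>t. 1 - (1 + \<Lambda>) * indicator A t) has_integral u y - u x) {x..y}"
    by (rule iffD1[OF has_integral_AE, rotated]) (use D in \<open>auto elim: eventually_mono split: split_indicator\<close>)
  have "emeasure lborel (A \<inter> {x..y}) \<le> emeasure lborel {x..y}"
    by (intro emeasure_mono) auto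
  then have "emeasure lborel (A \<inter> {x..y}) < \<infinity>"
    by (rule order_le_less_trans) (simp add: emeasure_lborel_Icc_eq)
  then have "((\<lambda>_. 1) has_integral measure lborel (A \<inter> {x..y})) (A \<inter> {x..y})"
    by (intro has_integral_measure_lborel) auto
  then have "((\<lambda>t. indicator A t) has_integral measure lborel (A \<inter> {x..y})) {x..y}"
    by (subst (asm) has_integral_restrict_Int[symmetric]) (simp add: indicator_def of_bool_def cong: if_cong)
  then have "((\<lambda>t. 1 - (1 + \<Lambda>) * indicator A t) has_integral (y - x) - (1 + \<Lambda>) * measure lborel (A \<inter> {x..y})) {x..y}"
    using has_integral_const_real[of "1::real" x y] \<open>x \<le> y\<close>
    by (intro has_integral_diff has_integral_mult_right) simp_all
  with 1 show ?thesis by (rule has_integral_unique)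
qed

section \<open>Sorting an unordered family of drops\<close>

locale drop_family =
  fixes \<Lambda> \<delta> T :: real and L :: nat and b :: "nat \<Rightarrow> real" and u :: "real \<Rightarrow> real"
  assumes Lambda_pos: "\<Lambda> > 0" and delta_pos: "\<delta> > 0" and L_pos: "L \<ge> 1"
    and T_eq: "T = real L * (\<Lambda> + 1) * \<delta>"
    and separated: "i \<noteq> j \<Longrightarrow> \<delta> \<le> \<bar>b i - b j\<bar>"
    and increment: "x \<le> y \<Longrightarrow> u y - u x = (y - x) - (1 + \<Lambda>) * measure lborel ((\<Union>k. {b k..<b k + \<delta>}) \<inter> {x..y})"
    and u_periodic: "u (x + T) = u x"
begin

definition A :: "real set" where "A = (\<Union>k. {b k..<b k + \<delta>})"

lemma A_measurable [measurable]: "A \<in> sets borel"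
  unfolding A_def by measurable

text \<open>\<open>N x\<close> is the signed measure of \<open>A\<close> between \<open>b 0\<close> and \<open>x\<close>.\<close>

definition N :: "real \<Rightarrow> real" where
  "N x = (x - b 0 - (u x - u (b 0))) / (1 + \<Lambda>)"

lemma N_diff: "x \<le> y \<Longrightarrow> N y - N x = measure lborel (A \<inter> {x..y})"
proof -
  assume "x \<le> y"
  have "N y - N x = ((y - x) - (u y - u x)) / (1 + \<Lambda>)"
    by (simp add: N_def diff_divide_distrib)
  then show ?thesis using increment[OF \<open>x \<le> y\<close>] Lambda_pos by (simp add: A_def)
qed

lemma emeasure_A_Icc: "x \<le> y \<Longrightarrow> emeasure lborel (A \<inter> {x..y}) = ennreal (N y - N x)"
proof -
  assume "x \<le> y"
  have "emeasure lborel (A \<inter> {x..y}) \<le> emeasure lborel {x..y}"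
    by (intro emeasure_mono) auto
  also have "\<dots> < \<infinity>" by (simp add: emeasure_lborel_Icc_eq)
  finally show ?thesis unfolding N_diff[OF \<open>x \<le> y\<close>] by (intro emeasure_eq_ennreal_measure) auto
qed

lemma N_mono: "x \<le> y \<Longrightarrow> N x \<le> N y"
  using N_diff[of x y] measure_nonneg[of lborel "A \<inter> {x..y}"] by linarith

lemma N_lipschitz: "x \<le> y \<Longrightarrow> N y \<le> N x + (y - x)"
proof -
  assume "x \<le> y"
  have "ennreal (N y - N x) \<le> emeasure lborel {x..y}"
    unfolding emeasure_A_Icc[OF \<open>x \<le> y\<close>, symmetric] by (intro emeasure_mono) auto
  then show ?thesis using \<open>x \<le> y\<close> by simp
qed

lemma N_b_0: "N (b 0) = 0"
  by (simp add: N_def)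

text \<open>As \<open>u\<close> returns after a period, \<open>N\<close> gains
  \<open>T / (1 + \<Lambda>)\<close>, the length of \<open>L\<close> drops.\<close>

lemma N_periodic: "N (x + of_int n * T) = N x + of_int n * (real L * \<delta>)"
proof -
  interpret periodic_fun_simple u T by standard (rule u_periodic)
  have "T / (1 + \<Lambda>) = real L * \<delta>"
    using Lambda_pos by (simp add: T_eq field_simps)
  moreover have "N (x + of_int n * T) = N x + of_int n * (T / (1 + \<Lambda>))"
    unfolding N_def plus_of_int by (simp add: add_divide_distrib[symmetric])
  ultimately show ?thesis by simp
qed

text \<open>The upper bound is the Lipschitz bound; the lower one holds because the drop lies in
  \<open>A\<close>.\<close>

lemma N_drop:
  assumes "0 \<le> r" "r \<le> \<delta>"
  shows "N (b j + r) = N (b j) + r"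
proof (rule antisym)
  show "N (b j + r) \<le> N (b j) + r" using N_lipschitz[of "b j" "b j + r"] assms by simp
  have "{b j..<b j + r} \<subseteq> A \<inter> {b j..b j + r}" using assms by (force simp: A_def)
  then have "emeasure lborel {b j..<b j + r} \<le> emeasure lborel (A \<inter> {b j..b j + r})"
    by (intro emeasure_mono) auto
  then have "ennreal r \<le> ennreal (N (b j + r) - N (b j))" using assms by (simp add: emeasure_A_Icc)
  then show "N (b j) + r \<le> N (b j + r)" using assms N_mono[of "b j" "b j + r"] by simp
qed

text \<open>So \<open>b j\<close> is the last point of its level set of \<open>N\<close>; this is
  how drops are recognized from levels.\<close>

lemma N_gt:
  assumes "b j < x"
  shows "N (b j) < N x"
proof (cases "x \<le> b j + \<delta>")
  case True
  then show ?thesis using N_drop[of "x - b j" j] assms by simp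
next
  case False
  then show ?thesis using N_drop[of \<delta> j] N_mono[of "b j + \<delta>" x] delta_pos by simp
qed

lemma b_diff: "b i < b j \<Longrightarrow> b i + \<delta> \<le> b j"
  using separated[of i j] by (cases "i = j") auto

text \<open>By separation only whole drops lie between two drop starts, so the difference of
  \<open>N\<close> counts them.\<close>

lemma N_b_diff:
  assumes "b i \<le> b j"
  shows "\<exists>n::nat. N (b j) - N (b i) = real n * \<delta>"
proof -
  define K where "K = {k. b i \<le> b k \<and> b k < b j}"
  \<comment> \<open>The point \<open>b j\<close> is taken out because it already belongs to drop
    \<open>j\<close>.\<close>
  have "A \<inter> {b i..b j} - {b j} = (\<Union>k\<in>K. {b k..<b k + \<delta>})"
  proof (intro equalityI subsetI)
    fix x assume "x \<in> A \<inter> {b i..b j} - {b j}"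
    then obtain k where k: "b k \<le> x" "x < b k + \<delta>" and x: "b i \<le> x" "x < b j" by (auto simp: A_def)
    have "b i \<le> b k" using b_diff[of k i] k x by linarith
    then show "x \<in> (\<Union>k\<in>K. {b k..<b k + \<delta>})" using k x by (auto simp: K_def intro!: bexI[of _ k])
  next
    fix x assume "x \<in> (\<Union>k\<in>K. {b k..<b k + \<delta>})"
    then obtain k where k: "b k \<le> x" "x < b k + \<delta>" "b i \<le> b k" "b k < b j" by (auto simp: K_def)
    then show "x \<in> A \<inter> {b i..b j} - {b j}" using b_diff[of k j] by (auto simp: A_def)
  qed
  then have "emeasure lborel (\<Union>k\<in>K. {b k..<b k + \<delta>}) = emeasure lborel (A \<inter> {b i..b j})"
    using emeasure_Diff_null_set[OF countable_imp_null_set_lborel, of "{b j}" "A \<inter> {b i..b j}"] by simp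
  moreover have "disjoint_family_on (\<lambda>k. {b k..<b k + \<delta>}) K"
    unfolding disjoint_family_on_def using separated by force
  then have "emeasure lborel (\<Union>k\<in>K. {b k..<b k + \<delta>}) = (\<integral>\<^sup>+k. emeasure lborel {b k..<b k + \<delta>} \<partial>count_space K)"
    by (intro emeasure_UN_countable) auto
  ultimately have eq: "ennreal (N (b j) - N (b i)) = ennreal \<delta> * emeasure (count_space K) K"
    using delta_pos by (simp add: emeasure_A_Icc[OF assms])
  have "finite K"
  proof (rule ccontr)
    assume "infinite K"
    then have "ennreal (N (b j) - N (b i)) = \<infinity>" using eq delta_pos by (simp add: ennreal_mult_top)
    then show False by simp
  qed
  then have "ennreal (N (b j) - N (b i)) = ennreal (\<delta> * real (card K))"
    using eq delta_pos by (simp add: ennreal_mult ennreal_of_nat_eq_real_of_nat)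
  then have "N (b j) - N (b i) = \<delta> * real (card K)"
    using N_mono[OF assms] delta_pos by (subst (asm) ennreal_inj) auto
  then show ?thesis by (auto simp: mult.commute)
qed

lemma N_b_multiple: obtains m :: int where "N (b j) = of_int m * \<delta>"
proof (cases "b 0 \<le> b j")
  case True
  from N_b_diff[OF this] obtain n where "N (b j) = real n * \<delta>" by (auto simp: N_b_0)
  then show ?thesis by (intro that[of "int n"]) simp
next
  case False
  then have "b j \<le> b 0" by simp
  from N_b_diff[OF this] obtain n where "N (b 0) - N (b j) = real n * \<delta>" by blast
  then have "N (b j) = of_int (- int n) * \<delta>" by (simp add: N_b_0)
  then show ?thesis by (rule that)
qed

text \<open>The last point \<open>c\<close> with \<open>N\<close> at most
  \<open>k * \<delta>\<close> lies exactly on that level, and \<open>N\<close> grows right after it.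
  Hence a drop occurs just to the right of \<open>c\<close>, and since drops start at multiples of
  \<delta>, it starts at this level.\<close>

lemma drop_at_level: "\<exists>j. N (b j) = of_int k * \<delta>"
proof -
  define S where "S = {x. N x \<le> of_int k * \<delta>}"
  define c where "c = Sup S"
  \<comment> \<open>Each period changes \<open>N\<close> by at least \<delta>, so about
    \<open>\<bar>k\<bar>\<close> periods to either side of \<open>b 0\<close> pass the
    level.\<close>
  have k_le: "\<bar>of_int k * \<delta>\<bar> \<le> of_int \<bar>k\<bar> * (real L * \<delta>)"
    using L_pos delta_pos mult_left_mono[of 1 "real L" "\<bar>of_int k\<bar> * \<delta>"] by (simp add: abs_mult ac_simps)
  have "b 0 + of_int (- \<bar>k\<bar>) * T \<in> S"
    using k_le unfolding S_def mem_Collect_eq N_periodic N_b_0 by simp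
  then have ne: "S \<noteq> {}" by auto
  have "N (b 0 + of_int (\<bar>k\<bar> + 1) * T) > of_int k * \<delta>"
  proof -
    have "0 < real L * \<delta>" using L_pos delta_pos by simp
    then show ?thesis using k_le unfolding N_periodic N_b_0
      by (simp only: of_int_add of_int_1 distrib_right mult_1_left add_0_left)
  qed
  then have "x \<le> b 0 + of_int (\<bar>k\<bar> + 1) * T" if "x \<in> S" for x
    using that N_mono[of "b 0 + of_int (\<bar>k\<bar> + 1) * T" x] unfolding S_def by fastforce
  then have bdd: "bdd_above S" by (auto simp: bdd_above_def)
  have c_gt: "N x > of_int k * \<delta>" if "x > c" for x
    using cSup_upper[OF _ bdd, of x] that by (force simp: c_def S_def)
  have c_ge: "N c \<ge> of_int k * \<delta>"
  proof (rule ccontr)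
    assume "\<not> ?thesis"
    then show False using c_gt[of "c + (of_int k * \<delta> - N c)"] N_lipschitz[of c "c + (of_int k * \<delta> - N c)"] by simp
  qed
  have c_le: "N c \<le> of_int k * \<delta>"
  proof (rule ccontr)
    assume *: "\<not> ?thesis"
    then obtain x where x: "x \<in> S" "c - (N c - of_int k * \<delta>) < x"
      using less_cSup_iff[OF ne bdd, of "c - (N c - of_int k * \<delta>)"] by (auto simp: c_def)
    moreover have "x \<le> c" using cSup_upper[OF x(1) bdd] by (simp add: c_def)
    ultimately show False using N_lipschitz[of x c] by (simp add: S_def)
  qed
  \<comment> \<open>A stretch of length \<open>\<delta> / 2\<close> keeps \<open>N x\<close>
    strictly below the next level, which forces \<open>m = k\<close> at the end.\<close>
  have "0 < N (c + \<delta> / 2) - N c" using c_gt[of "c + \<delta> / 2"] c_le delta_pos by simp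
  then have "emeasure lborel (A \<inter> {c..c + \<delta> / 2}) \<noteq> 0"
    using delta_pos by (subst emeasure_A_Icc) auto
  then have "A \<inter> {c..c + \<delta> / 2} \<noteq> {}" by (metis emeasure_empty)
  then obtain x j where x: "c \<le> x" "x \<le> c + \<delta> / 2" and j: "b j \<le> x" "x < b j + \<delta>"
    by (auto simp: A_def)
  obtain m where m: "N (b j) = of_int m * \<delta>" by (rule N_b_multiple)
  have "N x = of_int m * \<delta> + (x - b j)" using N_drop[of "x - b j" j] j m by simp
  moreover have "of_int k * \<delta> \<le> N x" "N x \<le> of_int k * \<delta> + \<delta> / 2"
    using N_mono[OF x(1)] N_lipschitz[OF x(1)] x c_le c_ge by auto
  ultimately have "of_int m * \<delta> < (of_int k + 1) * \<delta>" "of_int k * \<delta> < (of_int m + 1) * \<delta>"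
    using j delta_pos by (auto simp: distrib_right)
  then have "m = k" using delta_pos by (simp add: mult_less_cancel_right_pos)
  with m show ?thesis by blast
qed

text \<open>Numbering drops by their level makes order and periodicity visible: \<open>N\<close> is
  monotone and rises by \<open>L\<close> levels per period. Since a level has only one last point,
  the choice does not affect the value.\<close>

definition a :: "int \<Rightarrow> real" where
  "a k = b (SOME j. N (b j) = of_int k * \<delta>)"

lemma N_a: "N (a k) = of_int k * \<delta>"
  unfolding a_def by (rule someI_ex[OF drop_at_level])

lemma a_in_range: "a k \<in> range b"
  by (auto simp: a_def)

lemma last_at_level_unique:
  assumes "N x = N y" "\<And>z. z > x \<Longrightarrow> N z > N x" "\<And>z. z > y \<Longrightarrow> N z > N y"
  shows "x = y"
  using assms by (metis less_irrefl linorder_neqE)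

lemma N_gt_a: "z > a k \<Longrightarrow> N z > N (a k)"
  using a_in_range[of k] N_gt by auto

lemma range_a: "range a = range b"
proof (intro equalityI subsetI)
  fix x assume "x \<in> range b"
  then obtain j where j: "x = b j" by auto
  obtain m where m: "N (b j) = of_int m * \<delta>" by (rule N_b_multiple)
  have "b j = a m"
  proof (rule last_at_level_unique)
    show "N (b j) = N (a m)" by (simp add: m N_a)
  qed (rule N_gt N_gt_a, assumption)+
  with j show "x \<in> range a" by auto
qed (use a_in_range in auto)

text \<open>Increasing levels order the starts, and \<open>b_diff\<close> gives the gap. Both
  \<open>a (k + int L)\<close> and \<open>a k + T\<close> are the last point of the same
  level.\<close>

lemma drop_sequence_a: "drop_sequence \<Lambda> \<delta> T L a"
proof
  show "a k + \<delta> \<le> a (k + 1)" for k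
  proof -
    have "N (a k) < N (a (k + 1))" using delta_pos by (simp add: N_a)
    then have "a k < a (k + 1)" using N_mono[of "a (k + 1)" "a k"] by linarith
    then show ?thesis using a_in_range[of k] a_in_range[of "k + 1"] b_diff by auto
  qed
  show "a (k + int L) = a k + T" for k
  proof (rule last_at_level_unique)
    have N_T: "N (x + T) = N x + real L * \<delta>" for x using N_periodic[of x 1] by simp
    show "N (a (k + int L)) = N (a k + T)" unfolding N_T by (simp add: N_a distrib_right)
    show "N (a k + T) < N z" if "a k + T < z" for z
      using N_gt_a[of k "z - T"] N_T[of "z - T"] N_T[of "a k"] that by simp
  qed (rule N_gt_a)
qed (use Lambda_pos delta_pos L_pos T_eq in auto)

lemma sawtooth_a: "sawtooth \<Lambda> \<delta> T L a u"
proof (intro sawtooth.intro drop_sequence_a sawtooth_axioms.intro u_periodic)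
  have "(\<Union>k. {a k..<a k + \<delta>}) = (\<Union>x\<in>range b. {x..<x + \<delta>})"
    by (simp flip: range_a)
  then have "drop_sequence.drops \<delta> a = A"
    unfolding drop_sequence.drops_def[OF drop_sequence_a] A_def by simp
  then show "u y - u x = (y - x) - (1 + \<Lambda>) * measure lborel (drop_sequence.drops \<delta> a \<inter> {x..y})" if "x \<le> y" for x y
    using increment[OF that] by (simp add: A_def)
qed

end

section \<open>From admissible functions to drop families\<close>

lemma interval_of_length:
  fixes I :: "real set"
  assumes I: "is_interval I" and len: "emeasure lborel I = ennreal \<delta>" and "\<delta> > 0"
  obtains b where "{b<..<b + \<delta>} \<subseteq> I" "I \<subseteq> {b..b + \<delta>}"
proof -
  have [measurable]: "I \<in> sets borel" using I by (rule real_interval_borel_measurable)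
  have between: "x \<in> I \<Longrightarrow> y \<in> I \<Longrightarrow> {x..y} \<subseteq> I" for x y
    using I unfolding is_interval_1 by (meson atLeastAtMost_iff subsetI)
  have close: "y \<le> x + \<delta>" if "x \<in> I" "y \<in> I" for x y
  proof (cases "x \<le> y")
    case True
    have "emeasure lborel {x..y} \<le> emeasure lborel I"
      using between[OF that] by (intro emeasure_mono) auto
    then show ?thesis using True \<open>\<delta> > 0\<close> by (simp add: len)
  qed (use \<open>\<delta> > 0\<close> in simp)
  have ne: "I \<noteq> {}" using len \<open>\<delta> > 0\<close> by auto
  then obtain z where z: "z \<in> I" by blast
  have below: "bdd_below I" using close[OF _ z] by (intro bdd_belowI[of _ "z - \<delta>"]) force
  have above: "bdd_above I" using close[OF z] by (intro bdd_aboveI[of _ "z + \<delta>"]) force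
  define b c where "b = Inf I" and "c = Sup I"
  have sub: "I \<subseteq> {b..c}"
    using below above by (auto simp: b_def c_def intro: cInf_lower cSup_upper)
  have sup: "{b<..<c} \<subseteq> I"
  proof
    fix x assume "x \<in> {b<..<c}"
    then obtain y1 y2 where "y1 \<in> I" "y1 < x" "y2 \<in> I" "x < y2"
      using cInf_less_iff[OF ne below] less_cSup_iff[OF ne above] by (auto simp: b_def c_def)
    then show "x \<in> I" using between[of y1 y2] by auto
  qed
  have "b \<le> c" using sub ne by auto
  have "emeasure lborel I \<le> emeasure lborel {b..c}" "emeasure lborel {b<..<c} \<le> emeasure lborel I"
    using sub sup by (intro emeasure_mono; simp)+
  then have "ennreal \<delta> \<le> ennreal (c - b)" "ennreal (c - b) \<le> ennreal \<delta>" using \<open>b \<le> c\<close> by (simp_all add: len)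
  then have "c = b + \<delta>" using \<open>b \<le> c\<close> \<open>\<delta> > 0\<close> by simp
  with sub sup show ?thesis using that by blast
qed

text \<open>Near a point outside \<open>S\<close> the function is affine, and the almost everywhere
  condition holds at some point of that neighbourhood, which fixes the slope. The condition thus
  holds everywhere off \<open>S\<close>.\<close>

lemma piecewise_affine_derivative:
  assumes S: "\<And>a b. finite (S \<inter> {a..b})"
    and aff: "\<And>x y. x < y \<Longrightarrow> {x<..<y} \<inter> S = {} \<Longrightarrow> \<exists>m c. \<forall>t\<in>{x..y}. u t = m * t + c"
    and AE: "AE x in lborel. (u has_real_derivative p) (at x) \<or> (u has_real_derivative q) (at x)"
    and t: "t \<notin> S"
  shows "(u has_real_derivative p) (at t) \<or> (u has_real_derivative q) (at t)"
proof -
  \<comment> \<open>The distance from \<open>t\<close> to the nearest breakpoint, capped at 1 so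
    that only finitely many breakpoints enter.\<close>
  define e where "e = Min (insert 1 ((\<lambda>z. \<bar>z - t\<bar>) ` (S \<inter> {t - 1..t + 1})))"
  have fin: "finite (insert 1 ((\<lambda>z. \<bar>z - t\<bar>) ` (S \<inter> {t - 1..t + 1})))" using S by simp
  then have e: "e > 0" unfolding e_def using t by (subst Min_gr_iff) auto
  have "{t - e<..<t + e} \<inter> S = {}"
  proof (rule ccontr)
    assume "\<not> ?thesis"
    then obtain z where "z \<in> S" "t - e < z" "z < t + e" by auto
    then have z: "z \<in> S" "\<bar>z - t\<bar> < e" by auto
    have "e \<le> 1" unfolding e_def using fin by (intro Min_le) auto
    with z have "z \<in> {t - 1..t + 1}" by auto
    then have "e \<le> \<bar>z - t\<bar>" unfolding e_def using fin z by (intro Min_le) auto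
    with z show False by simp
  qed
  with aff[of "t - e" "t + e"] e obtain m c where u: "\<And>z. z \<in> {t - e..t + e} \<Longrightarrow> u z = m * z + c" by auto
  have der: "(u has_real_derivative m) (at z)" if "z \<in> {t - e<..<t + e}" for z
  proof (rule has_field_derivative_transform_within_open)
    show "((\<lambda>z. m * z + c) has_real_derivative m) (at z)" by (auto intro!: derivative_eq_intros)
    show "open {t - e<..<t + e}" by simp
    show "m * x + c = u x" if "x \<in> {t - e<..<t + e}" for x using u[of x] that by simp
  qed fact
  obtain z where "t - e < z" "z < t + e" "(u has_real_derivative p) (at z) \<or> (u has_real_derivative q) (at z)"
    using AE by (rule AE_lborel_in_Ioo[where a = "t - e" and b = "t + e"]) (use e in auto)
  then have "m = p \<or> m = q" using der[of z] DERIV_unique by auto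
  then show ?thesis using der[of t] e by auto
qed

lemma admissible_sawtooth:
  assumes u: "u \<in> admissible T \<Lambda> \<delta>"
    and pos: "\<Lambda> > 0" "\<delta> > 0" "L \<ge> 1" and T: "T = real L * (\<Lambda> + 1) * \<delta>"
  obtains a where "sawtooth \<Lambda> \<delta> T L a u"
proof -
  have cont: "continuous_on UNIV u" and per: "\<And>x. u (x + T) = u x"
    and "piecewise_affine u"
    and AE: "AE x in lborel. (u has_real_derivative 1) (at x) \<or> (u has_real_derivative (- \<Lambda>)) (at x)"
    using u unfolding admissible_def by auto
  from u obtain I :: "nat \<Rightarrow> real set" where
    I': "\<forall>k. is_interval (I k) \<and> emeasure lborel (I k) = ennreal \<delta>"
      "\<forall>i j. i \<noteq> j \<longrightarrow> finite (I i \<inter> I j) \<and> card (I i \<inter> I j) \<le> 1"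
      "AE x in lborel. (u has_real_derivative (- \<Lambda>)) (at x) \<longleftrightarrow> x \<in> (\<Union>k. I k)"
    unfolding admissible_def by blast
  then have I: "\<And>k. is_interval (I k)" "\<And>k. emeasure lborel (I k) = ennreal \<delta>"
      "\<And>i j. i \<noteq> j \<Longrightarrow> finite (I i \<inter> I j)"
      "AE x in lborel. (u has_real_derivative (- \<Lambda>)) (at x) \<longleftrightarrow> x \<in> (\<Union>k. I k)"
    by blast+
  from \<open>piecewise_affine u\<close> obtain S where "\<forall>a b. finite (S \<inter> {a..b})"
    "\<forall>x y. x < y \<and> {x<..<y} \<inter> S = {} \<longrightarrow> (\<exists>m c. \<forall>t\<in>{x..y}. u t = m * t + c)"
    unfolding piecewise_affine_def by blast
  then have S: "\<And>a b. finite (S \<inter> {a..b})"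
    "\<And>x y. x < y \<Longrightarrow> {x<..<y} \<inter> S = {} \<Longrightarrow> \<exists>m c. \<forall>t\<in>{x..y}. u t = m * t + c"
    by blast+
  have "\<exists>b. {b<..<b + \<delta>} \<subseteq> I k \<and> I k \<subseteq> {b..b + \<delta>}" for k
    using interval_of_length[OF I(1,2) \<open>\<delta> > 0\<close>] by metis
  then obtain b where b: "\<And>k. {b k<..<b k + \<delta>} \<subseteq> I k" "\<And>k. I k \<subseteq> {b k..b k + \<delta>}" by metis
  \<comment> \<open>Left ends closer than \<delta> would make \<open>I i\<close> and
    \<open>I j\<close> share an open interval, hence infinitely many points.\<close>
  have sep: "\<delta> \<le> \<bar>b i - b j\<bar>" if "i \<noteq> j" for i j
  proof (rule ccontr)
    assume "\<not> ?thesis"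
    then have "infinite {max (b i) (b j)<..<min (b i) (b j) + \<delta>}" by (intro infinite_Ioo) auto
    moreover have "{max (b i) (b j)<..<min (b i) (b j) + \<delta>} \<subseteq> I i \<inter> I j"
    proof
      fix x assume "x \<in> {max (b i) (b j)<..<min (b i) (b j) + \<delta>}"
      then have "x \<in> {b i<..<b i + \<delta>}" "x \<in> {b j<..<b j + \<delta>}" by auto
      then show "x \<in> I i \<inter> I j" using b(1) by (meson IntI subsetD)
    qed
    ultimately show False using I(3)[OF that] finite_subset by metis
  qed
  let ?A = "\<Union>k. {b k..<b k + \<delta>}"
  let ?D = "{x. (u has_real_derivative (- \<Lambda>)) (at x)}"
  \<comment> \<open>Passing from \<open>I k\<close> to half-open intervals affects only these
    countably many end points.\<close>
  have "AE x in lborel. x \<notin> range b \<union> range (\<lambda>k. b k + \<delta>)"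
    by (intro AE_not_in countable_imp_null_set_lborel) auto
  with I(4) have D: "AE x in lborel. x \<in> ?D \<longleftrightarrow> x \<in> ?A"
  proof eventually_elim
    case (elim x)
    have "x \<in> I k \<longleftrightarrow> x \<in> {b k..<b k + \<delta>}" for k
    proof -
      have "x \<noteq> b k" "x \<noteq> b k + \<delta>" using elim(2) by auto
      then show ?thesis using subsetD[OF b(1), of x k] subsetD[OF b(2), of x k] by auto
    qed
    then have "x \<in> (\<Union>k. I k) \<longleftrightarrow> x \<in> ?A" by blast
    with elim(1) show ?case by simp
  qed
  have der: "(u has_real_derivative (if t \<in> ?D then - \<Lambda> else 1)) (at t)" if "t \<notin> S" for t
    using piecewise_affine_derivative[OF S AE that] by auto
  interpret drop_family \<Lambda> \<delta> T L b u
  proof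
    show "u y - u x = (y - x) - (1 + \<Lambda>) * measure lborel (?A \<inter> {x..y})" if "x \<le> y" for x y
      by (rule increment_eq_measure[OF cont S(1) _ der D that]) auto
  qed (use pos T sep per in auto)
  show ?thesis using sawtooth_a by (rule that)
qed

section \<open>The equally spaced sawtooth\<close>

locale ubar_params =
  fixes \<Lambda> \<delta> :: real
  assumes Lambda_pos: "\<Lambda> > 0" and delta_pos: "\<delta> > 0"
begin

abbreviation P :: real where "P \<equiv> (\<Lambda> + 1) * \<delta>"

lemma P_eq: "P = \<Lambda> * \<delta> + \<delta>" and P_pos: "P > 0" and Ld_pos: "\<Lambda> * \<delta> > 0"
  using Lambda_pos delta_pos by (auto simp: distrib_right intro!: add_pos_pos)

lemma ubar_on_cell:
  assumes "of_int k * P - \<delta> < x" "x \<le> of_int k * P + \<Lambda> * \<delta>"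
  shows "ubar \<Lambda> \<delta> x = (if x - of_int k * P < 0 then - \<Lambda> * (x - of_int k * P) else x - of_int k * P)"
proof -
  have "\<lceil>(x - \<Lambda> * \<delta>) / P\<rceil> = k"
    using assms P_pos P_eq by (intro ceiling_unique) (auto simp: field_simps)
  then show ?thesis by (simp add: ubar_def Let_def mult.commute)
qed

text \<open>This point belongs to the preceding cell, whose rise ends at the value the drop starts
  from. The drop formula therefore extends to the closed interval.\<close>

lemma ubar_left_end: "ubar \<Lambda> \<delta> (of_int k * P - \<delta>) = \<Lambda> * \<delta>"
proof -
  have "ubar \<Lambda> \<delta> (of_int k * P - \<delta>) = of_int k * P - \<delta> - of_int (k - 1) * P"
    using P_pos P_eq Ld_pos delta_pos by (subst ubar_on_cell[of "k - 1"]) (auto simp: left_diff_distrib)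
  then show ?thesis using P_eq by (simp add: left_diff_distrib)
qed

lemma ubar_drop: "of_int k * P - \<delta> \<le> x \<Longrightarrow> x \<le> of_int k * P \<Longrightarrow> ubar \<Lambda> \<delta> x = - \<Lambda> * (x - of_int k * P)"
  using ubar_left_end[of k] ubar_on_cell[of k x] Ld_pos by (cases "x = of_int k * P - \<delta>") auto

lemma ubar_rise: "of_int k * P \<le> x \<Longrightarrow> x \<le> of_int k * P + \<Lambda> * \<delta> \<Longrightarrow> ubar \<Lambda> \<delta> x = x - of_int k * P"
  using ubar_on_cell[of k x] delta_pos by auto

text \<open>A maximum of two affine functions covers the lower corner by one continuous formula, and
  \<open>ubar_peak\<close> covers the upper corner by a minimum. Continuity then needs no one-sided
  limits.\<close>

lemma ubar_valley:
  "of_int k * P - \<delta> \<le> x \<Longrightarrow> x \<le> of_int k * P + \<Lambda> * \<delta> \<Longrightarrow> ubar \<Lambda> \<delta> x = max (- \<Lambda> * (x - of_int k * P)) (x - of_int k * P)"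
proof (cases "x \<le> of_int k * P")
  case True
  then have "\<Lambda> * (x - of_int k * P) \<le> 0" using Lambda_pos by (simp add: mult_nonneg_nonpos)
  moreover assume "of_int k * P - \<delta> \<le> x"
  ultimately show ?thesis using ubar_drop[of k x] True by (simp add: max_def)
next
  case False
  then have "0 \<le> \<Lambda> * (x - of_int k * P)" using Lambda_pos by simp
  moreover assume "x \<le> of_int k * P + \<Lambda> * \<delta>"
  ultimately show ?thesis using ubar_rise[of k x] False by (simp add: max_def)
qed

lemma ubar_peak:
  assumes "of_int (k - 1) * P \<le> x" "x \<le> of_int k * P"
  shows "ubar \<Lambda> \<delta> x = min (x - of_int (k - 1) * P) (- \<Lambda> * (x - of_int k * P))"
proof -
  \<comment> \<open>The signed distance of \<open>x\<close> from the peak.\<close>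
  define r where "r = x - (of_int k * P - \<delta>)"
  have 1: "x - of_int (k - 1) * P = \<Lambda> * \<delta> + r" using P_eq by (simp add: r_def left_diff_distrib)
  have 2: "- \<Lambda> * (x - of_int k * P) = \<Lambda> * \<delta> - \<Lambda> * r" by (simp add: r_def algebra_simps)
  show ?thesis
  proof (cases "r \<ge> 0")
    case True
    then have "0 \<le> \<Lambda> * r" using Lambda_pos by simp
    then show ?thesis using ubar_drop[of k x] True assms unfolding 1 2 by (auto simp: r_def min_def)
  next
    case False
    then have "\<Lambda> * r \<le> 0" using Lambda_pos by (simp add: mult_nonneg_nonpos)
    moreover have "ubar \<Lambda> \<delta> x = x - of_int (k - 1) * P"
      using False assms P_eq by (intro ubar_rise) (auto simp: r_def left_diff_distrib)
    ultimately show ?thesis using False unfolding 1 2 by (auto simp: min_def)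
  qed
qed

lemma cell_exists: obtains k where "of_int k * P - \<delta> \<le> x" "x < of_int k * P + \<Lambda> * \<delta>"
proof -
  define k where "k = \<lfloor>(x + \<delta>) / P\<rfloor>"
  have "of_int k \<le> (x + \<delta>) / P" "(x + \<delta>) / P < of_int k + 1" by (auto simp: k_def)
  then have "of_int k * P \<le> x + \<delta>" "x + \<delta> < (of_int k + 1) * P"
    using P_pos by (auto simp: pos_le_divide_eq pos_divide_less_eq)
  then show ?thesis using P_eq by (intro that[of k]) (auto simp: distrib_right)
qed

lemma continuous_ubar: "isCont (ubar \<Lambda> \<delta>) x"
proof -
  obtain k where k: "of_int k * P - \<delta> \<le> x" "x < of_int k * P + \<Lambda> * \<delta>" by (rule cell_exists)
  have transfer: "isCont (ubar \<Lambda> \<delta>) x"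
    if "isCont g x" "x \<in> {l<..<r}" "\<And>y. y \<in> {l<..<r} \<Longrightarrow> ubar \<Lambda> \<delta> y = g y" for g l r
  proof -
    have "\<forall>\<^sub>F y in nhds x. ubar \<Lambda> \<delta> y = g y"
      using eventually_nhds_in_open[of "{l<..<r}" x] that(2,3) by (auto elim: eventually_mono)
    then show ?thesis using that(1) by (simp add: isCont_cong)
  qed
  show ?thesis
  proof (cases "x = of_int k * P - \<delta>")
    case True
    show ?thesis
    proof (rule transfer)
      show "isCont (\<lambda>y. min (y - of_int (k - 1) * P) (- \<Lambda> * (y - of_int k * P))) x"
        by (intro continuous_intros)
      show "x \<in> {of_int (k - 1) * P<..<of_int k * P}"
        using True P_eq Ld_pos delta_pos by (simp add: left_diff_distrib)
      show "ubar \<Lambda> \<delta> y = min (y - of_int (k - 1) * P) (- \<Lambda> * (y - of_int k * P))"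
        if "y \<in> {of_int (k - 1) * P<..<of_int k * P}" for y
        using that by (intro ubar_peak) auto
    qed
  next
    case False
    show ?thesis
    proof (rule transfer)
      show "isCont (\<lambda>y. max (- \<Lambda> * (y - of_int k * P)) (y - of_int k * P)) x"
        by (intro continuous_intros)
      show "x \<in> {of_int k * P - \<delta><..<of_int k * P + \<Lambda> * \<delta>}" using False k by simp
      show "ubar \<Lambda> \<delta> y = max (- \<Lambda> * (y - of_int k * P)) (y - of_int k * P)"
        if "y \<in> {of_int k * P - \<delta><..<of_int k * P + \<Lambda> * \<delta>}" for y
        using that by (intro ubar_valley) auto
    qed
  qed
qed

lemma ubar_periodic: "ubar \<Lambda> \<delta> (x + of_int n * P) = ubar \<Lambda> \<delta> x"
proof -
  obtain k where k: "of_int k * P - \<delta> \<le> x" "x < of_int k * P + \<Lambda> * \<delta>" by (rule cell_exists)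
  then show ?thesis
    using ubar_valley[of k x] ubar_valley[of "k + n" "x + of_int n * P"] by (simp add: distrib_right)
qed

text \<open>The parameter \<open>x0\<close> marks the bottom of drop 0, as \<open>ubar\<close> has
  its minimum at 0; hence the offset by \<delta>.\<close>

definition starts :: "real \<Rightarrow> int \<Rightarrow> real" where
  "starts x0 k = x0 - \<delta> + of_int k * P"

definition breaks :: "real \<Rightarrow> real set" where
  "breaks x0 = range (starts x0) \<union> range (\<lambda>k. starts x0 k + \<delta>)"

lemma finite_breaks: "finite (breaks x0 \<inter> {l..r})"
proof -
  have *: "finite (range (\<lambda>k. c + of_int k * P) \<inter> {l..r})" for c
  proof (rule finite_subset)
    show "range (\<lambda>k. c + of_int k * P) \<inter> {l..r} \<subseteq> (\<lambda>k. c + of_int k * P) ` {\<lceil>(l - c) / P\<rceil>..\<lfloor>(r - c) / P\<rfloor>}"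
    proof
      fix x assume "x \<in> range (\<lambda>k. c + of_int k * P) \<inter> {l..r}"
      then obtain k where k: "x = c + of_int k * P" "l \<le> x" "x \<le> r" by auto
      then have "(l - c) / P \<le> of_int k" "of_int k \<le> (r - c) / P"
        using P_pos by (auto simp: pos_divide_le_eq pos_le_divide_eq)
      then show "x \<in> (\<lambda>k. c + of_int k * P) ` {\<lceil>(l - c) / P\<rceil>..\<lfloor>(r - c) / P\<rfloor>}"
        using k by (auto simp: ceiling_le_iff le_floor_iff)
    qed
  qed simp
  show ?thesis
    unfolding breaks_def starts_def Int_Un_distrib2
    using *[of "x0 - \<delta>"] *[of x0] by (simp add: add.commute algebra_simps)
qed

lemma countable_breaks: "countable (breaks x0)"
  unfolding breaks_def by simp

context
  fixes x0 y0 :: real and v :: "real \<Rightarrow> real"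
  assumes v: "v = (\<lambda>x. ubar \<Lambda> \<delta> (x - x0) + y0)"
begin

lemma shifted_ubar_drop:
  "starts x0 k \<le> x \<Longrightarrow> x \<le> starts x0 k + \<delta> \<Longrightarrow> v x = - \<Lambda> * x + (\<Lambda> * (x0 + of_int k * P) + y0)"
  unfolding v starts_def by (subst ubar_drop[of k]) (auto simp: algebra_simps)

lemma shifted_ubar_rise:
  "starts x0 k + \<delta> \<le> x \<Longrightarrow> x \<le> starts x0 (k + 1) \<Longrightarrow> v x = 1 * x + (y0 - x0 - of_int k * P)"
  unfolding v starts_def using P_eq by (subst ubar_rise[of k]) (auto simp: distrib_right)

lemma starts_cases:
  obtains k where "starts x0 k \<le> x" "x < starts x0 k + \<delta>"
  | k where "starts x0 k + \<delta> \<le> x" "x < starts x0 (k + 1)"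
proof -
  obtain k where "of_int k * P - \<delta> \<le> x - x0" "x - x0 < of_int k * P + \<Lambda> * \<delta>" by (rule cell_exists)
  then have "starts x0 k \<le> x" "x < starts x0 (k + 1)" using P_eq by (auto simp: starts_def distrib_right)
  then show ?thesis using that(1)[of k] that(2)[of k] by linarith
qed

lemma shifted_ubar_continuous: "continuous_on UNIV v"
proof -
  have "isCont (\<lambda>x. ubar \<Lambda> \<delta> (x - x0)) x" for x
    by (rule isCont_o2[OF _ continuous_ubar]) (intro continuous_intros)
  then show ?thesis by (intro continuous_at_imp_continuous_on ballI) (simp add: v)
qed

lemma drop_sequence_starts:
  assumes "L \<ge> 1" "T = real L * (\<Lambda> + 1) * \<delta>"
  shows "drop_sequence \<Lambda> \<delta> T L (starts x0)"
proof
  show "starts x0 k + \<delta> \<le> starts x0 (k + 1)" for k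
    using Ld_pos P_eq by (simp add: starts_def distrib_right[of "of_int k"])
  show "starts x0 (k + int L) = starts x0 k + T" for k
    by (simp add: starts_def assms distrib_right[of "of_int k"])
qed (use assms Lambda_pos delta_pos in auto)

lemma shifted_ubar_derivative:
  assumes "x \<notin> breaks x0"
  shows "(v has_real_derivative (if x \<in> (\<Union>k. {starts x0 k..<starts x0 k + \<delta>}) then - \<Lambda> else 1)) (at x)"
proof -
  have aff: "(v has_real_derivative m) (at x)"
    if "x \<in> {l<..<r}" "\<And>y. y \<in> {l<..<r} \<Longrightarrow> v y = m * y + c" for l r m c
  proof (rule has_field_derivative_transform_within_open)
    show "((\<lambda>z. m * z + c) has_real_derivative m) (at x)" by (auto intro!: derivative_eq_intros)
    show "open {l<..<r}" by simp
    show "m * y + c = v y" if "y \<in> {l<..<r}" for y using \<open>\<And>y. y \<in> {l<..<r} \<Longrightarrow> v y = m * y + c\<close> that by simp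
  qed fact
  have no: "x \<noteq> starts x0 k" "x \<noteq> starts x0 k + \<delta>" for k using assms by (auto simp: breaks_def)
  show ?thesis
  proof (cases rule: starts_cases[of x])
    case (1 k)
    then have "x \<in> {starts x0 k<..<starts x0 k + \<delta>}" using no[of k] by auto
    then have "(v has_real_derivative - \<Lambda>) (at x)" by (rule aff) (rule shifted_ubar_drop[of k], auto)
    then show ?thesis using 1 by auto
  next
    case (2 k)
    then have "x \<in> {starts x0 k + \<delta><..<starts x0 (k + 1)}" using no[of k] by auto
    then have "(v has_real_derivative 1) (at x)" by (rule aff) (rule shifted_ubar_rise[of k], auto)
    moreover have "x \<notin> {starts x0 j..<starts x0 j + \<delta>}" for j
    proof -
      \<comment> \<open>The equally spaced starts repeat after every single drop, so
        \<open>L = 1\<close> gives access to the ordering of the drops.\<close>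
      interpret drop_sequence \<Lambda> \<delta> "real 1 * (\<Lambda> + 1) * \<delta>" 1 "starts x0"
        by (rule drop_sequence_starts) auto
      show ?thesis using 2 gap_less[of j k] gap_less[of "k + 1" j] delta_pos
        by (cases "j \<le> k"; cases "j = k"; cases "j = k + 1") auto
    qed
    ultimately show ?thesis by auto
  qed
qed

lemma shifted_ubar_piecewise_affine: "piecewise_affine v"
  unfolding piecewise_affine_def
proof (intro exI[of _ "breaks x0"] conjI allI impI finite_breaks)
  fix x y :: real assume xy: "x < y \<and> {x<..<y} \<inter> breaks x0 = {}"
  have "z \<le> x \<or> y \<le> z" if "z \<in> breaks x0" for z
    using xy that by (meson disjoint_iff greaterThanLessThan_iff not_less)
  then have no: "starts x0 k \<le> x \<or> y \<le> starts x0 k" "starts x0 k + \<delta> \<le> x \<or> y \<le> starts x0 k + \<delta>" for k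
    by (auto simp: breaks_def)
  show "\<exists>m c. \<forall>t\<in>{x..y}. v t = m * t + c"
  proof (cases rule: starts_cases[of "(x + y) / 2"])
    case (1 k)
    then have "starts x0 k \<le> x" "y \<le> starts x0 k + \<delta>" using no[of k] xy by auto
    then have "\<forall>t\<in>{x..y}. v t = - \<Lambda> * t + (\<Lambda> * (x0 + of_int k * P) + y0)"
      by (intro ballI shifted_ubar_drop) auto
    then show ?thesis by blast
  next
    case (2 k)
    then have "starts x0 k + \<delta> \<le> x" "y \<le> starts x0 (k + 1)" using no(2)[of k] no(1)[of "k + 1"] xy by auto
    then have "\<forall>t\<in>{x..y}. v t = 1 * t + (y0 - x0 - of_int k * P)"
      by (intro ballI shifted_ubar_rise) auto
    then show ?thesis by blast
  qed
qed

lemma shifted_ubar_periodic: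
  assumes "T = real L * (\<Lambda> + 1) * \<delta>"
  shows "v (x + T) = v x"
  using ubar_periodic[of "x - x0" "int L"] by (simp add: v assms algebra_simps)

lemma shifted_ubar_sawtooth:
  assumes "L \<ge> 1" "T = real L * (\<Lambda> + 1) * \<delta>"
  shows "sawtooth \<Lambda> \<delta> T L (starts x0) v"
proof -
  interpret drop_sequence \<Lambda> \<delta> T L "starts x0" by (rule drop_sequence_starts) fact+
  show ?thesis
  proof (unfold_locales)
    show "v y - v x = (y - x) - (1 + \<Lambda>) * measure lborel (drops \<inter> {x..y})" if "x \<le> y" for x y
      using shifted_ubar_derivative that
      by (intro increment_eq_measure[where A = drops and D = drops and S = "breaks x0"] shifted_ubar_continuous finite_breaks)
         (auto simp: drops_def)
    show "v (x + T) = v x" for x by (rule shifted_ubar_periodic) fact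
  qed
qed

lemma shifted_ubar_admissible:
  assumes "L \<ge> 1" "T = real L * (\<Lambda> + 1) * \<delta>"
  shows "v \<in> admissible T \<Lambda> \<delta>"
proof -
  interpret drop_sequence \<Lambda> \<delta> T L "starts x0" by (rule drop_sequence_starts) fact+
  have AE: "AE x in lborel. x \<notin> breaks x0"
    by (intro AE_not_in countable_imp_null_set_lborel countable_breaks)
  \<comment> \<open>\<open>int_decode\<close> renumbers the integer-indexed drops by naturals, as
    \<open>admissible\<close> demands.\<close>
  define I where "I n = {starts x0 (int_decode n)..<starts x0 (int_decode n) + \<delta>}" for n
  have UN: "(\<Union>n. I n) = (\<Union>k. {starts x0 k..<starts x0 k + \<delta>})"
  proof -
    have "(\<Union>n. I n) = (\<Union>k\<in>range int_decode. {starts x0 k..<starts x0 k + \<delta>})"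
      unfolding I_def image_image ..
    then show ?thesis unfolding surj_int_decode .
  qed
  have drop: "(v has_real_derivative - \<Lambda>) (at x)" if "x \<notin> breaks x0" "x \<in> (\<Union>n. I n)" for x
    using shifted_ubar_derivative[OF that(1)] unfolding if_P[OF that(2)[unfolded UN]] .
  have rise: "(v has_real_derivative 1) (at x)" if "x \<notin> breaks x0" "x \<notin> (\<Union>n. I n)" for x
    using shifted_ubar_derivative[OF that(1)] unfolding if_not_P[OF that(2)[unfolded UN]] .
  have slope: "AE x in lborel. (v has_real_derivative 1) (at x) \<or> (v has_real_derivative - \<Lambda>) (at x)"
    using AE by eventually_elim (blast intro: drop rise)
  have "AE x in lborel. (v has_real_derivative - \<Lambda>) (at x) \<longleftrightarrow> x \<in> (\<Union>n. I n)"
    using AE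
  proof eventually_elim
    case (elim x)
    \<comment> \<open>Since \<Lambda> is positive the two slopes differ, which yields the converse
      implication on the rises.\<close>
    have "\<not> (v has_real_derivative - \<Lambda>) (at x)" if "(v has_real_derivative 1) (at x)"
      using DERIV_unique[OF that, of "- \<Lambda>"] Lambda_pos by auto
    then show ?case using drop[OF elim] rise[OF elim] by blast
  qed
  moreover have "is_interval (I n)" "emeasure lborel (I n) = ennreal \<delta>" for n
    using delta_pos by (auto simp: I_def)
  moreover have "I i \<inter> I j = {}" if "i \<noteq> j" for i j
  proof (rule ccontr)
    assume "I i \<inter> I j \<noteq> {}"
    then obtain y where "y \<in> I i" "y \<in> I j" by blast
    then have "int_decode i = int_decode j" unfolding I_def by (rule in_drops_unique)
    with that show False by (simp add: int_decode_eq)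
  qed
  then have "\<forall>i j. i \<noteq> j \<longrightarrow> finite (I i \<inter> I j) \<and> card (I i \<inter> I j) \<le> 1" by simp
  ultimately have "\<exists>I :: nat \<Rightarrow> real set.
      (\<forall>k. is_interval (I k) \<and> emeasure lborel (I k) = ennreal \<delta>) \<and>
      (\<forall>i j. i \<noteq> j \<longrightarrow> finite (I i \<inter> I j) \<and> card (I i \<inter> I j) \<le> 1) \<and>
      (AE x in lborel. (v has_real_derivative - \<Lambda>) (at x) \<longleftrightarrow> x \<in> (\<Union>k. I k))"
    by (intro exI[of _ I]) blast
  then show ?thesis
    unfolding admissible_def mem_Collect_eq
    by (intro conjI allI shifted_ubar_continuous shifted_ubar_piecewise_affine shifted_ubar_periodic[OF assms(2)] slope)
qed

end

end

section \<open>Characterization of the minimizers\<close>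

theorem theorem1p3:
  fixes \<Lambda> \<delta> s T :: real and L :: nat
  assumes "\<Lambda> > 0" and "\<delta> > 0" and "L \<ge> 1"
    and "T = real L * (\<Lambda> + 1) * \<delta>"
    and "0 < s" and "s < 1"
  shows "\<forall>u. (u \<in> admissible T \<Lambda> \<delta> \<and> (\<forall>v \<in> admissible T \<Lambda> \<delta>. F_s T s u \<le> F_s T s v))
           \<longleftrightarrow> (\<exists>x0 y0. u = (\<lambda>x. ubar \<Lambda> \<delta> (x - x0) + y0))"
proof (intro allI iffI)
  interpret ubar_params \<Lambda> \<delta> using assms by unfold_locales
  have spacing: "starts x0 (k + 1) - starts x0 k = (\<Lambda> + 1) * \<delta>" for x0 k
    by (simp add: starts_def distrib_right)
  {
    fix u assume "\<exists>x0 y0. u = (\<lambda>x. ubar \<Lambda> \<delta> (x - x0) + y0)"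
    then obtain x0 y0 where u: "u = (\<lambda>x. ubar \<Lambda> \<delta> (x - x0) + y0)" by blast
    show "u \<in> admissible T \<Lambda> \<delta> \<and> (\<forall>v \<in> admissible T \<Lambda> \<delta>. F_s T s u \<le> F_s T s v)"
    proof (intro conjI ballI)
      show "u \<in> admissible T \<Lambda> \<delta>" by (rule shifted_ubar_admissible[OF u assms(3,4)])
      fix v assume "v \<in> admissible T \<Lambda> \<delta>"
      then obtain a where "sawtooth \<Lambda> \<delta> T L a v" by (rule admissible_sawtooth[OF _ assms(1-4)])
      then show "F_s T s u \<le> F_s T s v"
        by (rule F_s_equispaced_le[OF _ shifted_ubar_sawtooth[OF u assms(3,4)] spacing assms(5,6)])
    qed
  next
    fix u assume u: "u \<in> admissible T \<Lambda> \<delta> \<and> (\<forall>v \<in> admissible T \<Lambda> \<delta>. F_s T s u \<le> F_s T s v)"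
    then obtain a where a: "sawtooth \<Lambda> \<delta> T L a u" by (blast elim: admissible_sawtooth[OF _ assms(1-4)])
    \<comment> \<open>Otherwise the admissible function \<open>ubar\<close> itself would have
      strictly smaller energy.\<close>
    have gaps: "\<forall>k. a (k + 1) - a k = (\<Lambda> + 1) * \<delta>"
    proof (rule ccontr)
      assume "\<not> ?thesis"
      then have "F_s T s (\<lambda>x. ubar \<Lambda> \<delta> (x - 0) + 0) < F_s T s u"
        by (rule F_s_equispaced_less[OF a shifted_ubar_sawtooth[OF refl assms(3,4)] spacing assms(5,6)])
      moreover have "(\<lambda>x. ubar \<Lambda> \<delta> (x - 0) + 0) \<in> admissible T \<Lambda> \<delta>"
        by (rule shifted_ubar_admissible[OF refl assms(3,4)])
      ultimately show False using u by (meson leD)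
    qed
    have step: "a (k + 1) = a k + (\<Lambda> + 1) * \<delta>" for k
      using gaps[rule_format, of k] by linarith
    \<comment> \<open>The bottom of drop 0, following the convention of
      \<open>starts\<close>.\<close>
    define x0 where "x0 = a 0 + \<delta>"
    have "a k = starts x0 k" for k
    proof (induction k rule: int_induct[where k = 0])
      case base
      show ?case by (simp add: x0_def starts_def)
    next
      case (step1 k)
      then show ?case by (simp add: step starts_def distrib_right)
    next
      case (step2 k)
      then show ?case using step[of "k - 1"] by (simp add: starts_def left_diff_distrib)
    qed
    then have "a = starts x0" by (simp add: fun_eq_iff)
    then interpret U: sawtooth \<Lambda> \<delta> T L "starts x0" u using a by simp
    define w where "w = (\<lambda>x. ubar \<Lambda> \<delta> (x - x0) + 0)"
    interpret W: sawtooth \<Lambda> \<delta> T L "starts x0" w by (rule shifted_ubar_sawtooth[OF w_def assms(3,4)])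
    \<comment> \<open>With the same drops \<open>u\<close> and \<open>w\<close> have the same
      increments; the four instances cover both orders of \<open>0\<close> and
      \<open>x\<close>.\<close>
    have "u x - w x = u 0 - w 0" for x
      using U.increment[of 0 x] W.increment[of 0 x] U.increment[of x 0] W.increment[of x 0]
      by (cases "0 \<le> x") auto
    then have "u = (\<lambda>x. ubar \<Lambda> \<delta> (x - x0) + (u 0 - w 0))"
      by (auto simp: fun_eq_iff w_def algebra_simps)
    then show "\<exists>x0 y0. u = (\<lambda>x. ubar \<Lambda> \<delta> (x - x0) + y0)" by blast
  }
qed

end
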